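(* Let $X\subseteq W$. Then the following statements are equivalent: (i) the join $\bigvee X$ exists; (ii) $X$ is bounded in $W$; (iii) $X$ is finite and $\operatorname{conv}(\widehat{N}(X))\cap\operatorname{conv}(E)=\varnothing$; (iv) $X$ is finite and the convex sets $\operatorname{conv}(\widehat{N}(X))$ and $\operatorname{conv}(E)$ are strictly separated by a hyperplane. Moreover, in this case, $N(\bigvee X)=\operatorname{cone}_\Phi(N(X))$.
   Context: Setting. $V$ is a finite-dimensional real vector space with a symmetric bilinear form $B$. For $\alpha\in V$ with $B(\alpha,\alpha)\neq 0$, let $s_\alpha(v)=v-2\frac{B(\alpha,v)}{B(\alpha,\alpha)}\alpha$. For $A\subseteq V$, $\operatorname{cone}(A)$ is the set of finite non-negative linear combinations of elements of $A$ (so $\operatorname{cone}(\varnothing)=\{0\}$), and $\operatorname{conv}$ denotes convex hull. $(W,S)$ is a Coxeter system with $S$ finite, given with a geometric representation: $W\subseteq O_B(V)$ and each $s\in S$ equals $s_{\alpha_s}$, where $\Delta=\{\alpha_s\mid s\in S\}$ is a simple system, i.e. (1) $\Delta$ is positively linearly independent: if $\sum_{\alpha\in\Delta}a_\alpha\alpha=0$ with all $a_\alpha\ge 0$, then all $a_\alpha=0$; (2) for distinct $\alpha,\beta\in\Delta$, $B(\alpha,\beta)\in\,]-\infty,-1]\cup\{-\cos(\pi/k)\mid k\in\mathbb{Z}_{\ge 2}\}$; (3) $B(\alpha,\alpha)=1$ for all $\alpha\in\Delta$. ($B(\alpha_s,\alpha_t)=-\cos(\pi/m)$ if $st$ has finite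 order $m$, and $B(\alpha_s,\alpha_t)\le -1$ if $st$ has infinite order.) The root system is $\Phi=W(\Delta)$, the positive roots are $\Phi^+=\operatorname{cone}(\Delta)\cap\Phi$, and $\Phi^-=-\Phi^+$; one has $\Phi=\Phi^+\sqcup\Phi^-$. Weak order. $\ell$ is the length function of $(W,S)$. The (right) weak order is defined by $u\le w$ iff $\ell(w)=\ell(u)+\ell(u^{-1}w)$. The join $\bigvee X$ is the least upper bound of $X$ in $(W,\le)$, if it exists. $X$ is bounded in $W$ if there is $g\in W$ with $x\le g$ for all $x\in X$. Inversion sets. For $w\in W$, $N(w)=\Phi^+\cap w(\Phi^-)$; for $X\subseteq W$, $N(X)=\bigcup_{x\in X}N(x)$. For $A\subseteq V$, $\operatorname{cone}_\Phi(A)=\operatorname{cone}(A)\cap\Phi$. Normalized roots and limit roots. Fix an affine hyperplane $V_1$ of $V$ transverse to $\Phi^+$: for every $\beta\in\Phi^+$ the ray $\mathbb{R}^+\beta$ meets $V_1$ in a unique nonzero point $\widehat\beta$; put $\widehat{-\beta}=\widehat\beta$. For $A\subseteq\Phi$, $\widehat A=\{\widehat\beta\mid\beta\in A\}$, and $\widehat N(X)=\widehat{N(X)}$. $E\subseteq V_1$ is the set of accumulation points of $\widehat\Phi$ (the set of limit roots; $E=\varnothing$ if $W$ is finite), and $\operatorname{conv}(E)$ is the imaginary convex body. Two subsets $P,P'$ of $V_1$ are strictly separated by a hyperplane if there is a linear hyperplane $H=\ker\rho$ of $V$ ($\rho$ a nonzero linear form) with $\rho>0$ on $P$ and $\rho<0$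 on $P'$ (when both sets are non-empty this is the same as strict separation by an affine hyperplane of $V_1$). *)

theory Defs
  imports "HOL-Analysis.Analysis" "HOL-Algebra.Multiplicative_Group" "HOL-Algebra.Lattice"
begin

section \<open>Coxeter systems and the weak order\<close>

definition word_prod :: "('g, 'b) monoid_scheme \<Rightarrow> 'g list \<Rightarrow> 'g"
  where "word_prod G xs = foldr (\<lambda>x y. x \<otimes>\<^bsub>G\<^esub> y) xs \<one>\<^bsub>G\<^esub>"

text \<open>
  The congruence on words over \<open>S\<close> generated by the Coxeter relations \<open>(s t)\<^sup>m = 1\<close>, where \<open>m\<close> is
  the order of \<open>s t\<close> in \<open>G\<close>. In the library, \<^term>\<open>group.ord G x\<close> is \<open>0\<close> for an element of infinite
  order, so such a pair contributes only the trivial relation. If the elements of \<open>S\<close> are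
  involutions, the pairs \<open>s = t\<close> contribute \<open>s s = 1\<close>; hence formal inverses are not needed and
  the quotient of the words by this congruence is the group presented by the Coxeter relations.
\<close>

inductive coxeter_equiv :: "('g, 'b) monoid_scheme \<Rightarrow> 'g set \<Rightarrow> 'g list \<Rightarrow> 'g list \<Rightarrow> bool"
  for G S where
  relator: "\<lbrakk>s \<in> S; t \<in> S; xs \<in> lists S; ys \<in> lists S\<rbrakk> \<Longrightarrow>
    coxeter_equiv G S
      (xs @ concat (replicate (group.ord G (s \<otimes>\<^bsub>G\<^esub> t)) [s, t]) @ ys) (xs @ ys)"
| refl: "xs \<in> lists S \<Longrightarrow> coxeter_equiv G S xs xs"
| sym: "coxeter_equiv G S xs ys \<Longrightarrow> coxeter_equiv G S ys xs"
| trans: "\<lbrakk>coxeter_equiv G S xs ys; coxeter_equiv G S ys zs\<rbrakk> \<Longrightarrow> coxeter_equiv G S xs zs"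

locale coxeter_system = group G for G (structure) +
  fixes S
  assumes gens_closed: "S \<subseteq> carrier G"
    and gens_generate: "generate G S = carrier G"
    and gens_order: "\<And>s. s \<in> S \<Longrightarrow> ord s = 2"
    and presentation: "\<And>xs ys. \<lbrakk>xs \<in> lists S; ys \<in> lists S; word_prod G xs = word_prod G ys\<rbrakk>
      \<Longrightarrow> coxeter_equiv G S xs ys"

definition word_length :: "('g, 'b) monoid_scheme \<Rightarrow> 'g set \<Rightarrow> 'g \<Rightarrow> nat"
  where "word_length G S w = (LEAST n. \<exists>xs \<in> lists S. length xs = n \<and> word_prod G xs = w)"

text \<open>
  The right weak order, as an order structure, so that the library notions \<^const>\<open>Upper\<close>,
  \<^const>\<open>least\<close> and \<open>\<Squnion>\<^bsub>L\<^esub>X\<close> apply to it.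
\<close>

definition weak_order :: "('g, 'b) monoid_scheme \<Rightarrow> 'g set \<Rightarrow> 'g gorder"
  where "weak_order G S =
    \<lparr>carrier = carrier G, eq = (=),
     le = (\<lambda>u w. word_length G S w = word_length G S u + word_length G S (inv\<^bsub>G\<^esub> u \<otimes>\<^bsub>G\<^esub> w))\<rparr>"


section \<open>Geometric representations and roots\<close>

definition pos_comb :: "'v::real_vector set \<Rightarrow> 'v set"
  where "pos_comb A =
    {\<Sum>a\<in>T. c a *\<^sub>R a | T c. finite T \<and> T \<subseteq> A \<and> (\<forall>a\<in>T. 0 \<le> (c a :: real))}"

lemma pos_comb_eq_convex_cone_hull: "pos_comb A = convex_cone hull A"
proof (rule hull_unique [symmetric])
  show "A \<subseteq> pos_comb A"
  proof
    fix x assume "x \<in> A"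
    then show "x \<in> pos_comb A"
      unfolding pos_comb_def by (intro CollectI exI [of _ "{x}"] exI [of _ "\<lambda>_. 1"]) auto
  qed
  have zero: "0 \<in> pos_comb A"
    unfolding pos_comb_def by (intro CollectI exI [of _ "{}"]) auto
  have scale: "r *\<^sub>R x \<in> pos_comb A" if "x \<in> pos_comb A" "0 \<le> r" for x r
  proof -
    from that obtain T c where "x = (\<Sum>a\<in>T. c a *\<^sub>R a)" "finite T" "T \<subseteq> A" "\<forall>a\<in>T. 0 \<le> c a"
      unfolding pos_comb_def by blast
    with that(2) show ?thesis
      unfolding pos_comb_def
      by (intro CollectI exI [of _ T] exI [of _ "\<lambda>a. r * c a"]) (auto simp: scaleR_sum_right)
  qed
  have add: "x + y \<in> pos_comb A" if "x \<in> pos_comb A" "y \<in> pos_comb A" for x y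
  proof -
    from that(1) obtain T c where T: "x = (\<Sum>a\<in>T. c a *\<^sub>R a)" "finite T" "T \<subseteq> A" "\<forall>a\<in>T. 0 \<le> c a"
      unfolding pos_comb_def by blast
    from that(2) obtain U d where U: "y = (\<Sum>a\<in>U. d a *\<^sub>R a)" "finite U" "U \<subseteq> A" "\<forall>a\<in>U. 0 \<le> d a"
      unfolding pos_comb_def by blast
    define c' where "c' a = (if a \<in> T then c a else 0)" for a
    define d' where "d' a = (if a \<in> U then d a else 0)" for a
    have "x = (\<Sum>a\<in>T \<union> U. c' a *\<^sub>R a)"
      unfolding T(1) c'_def using T(2) U(2) by (intro sum.mono_neutral_cong_left) auto
    moreover have "y = (\<Sum>a\<in>T \<union> U. d' a *\<^sub>R a)"
      unfolding U(1) d'_def using T(2) U(2) by (intro sum.mono_neutral_cong_left) auto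
    ultimately have "x + y = (\<Sum>a\<in>T \<union> U. (c' a + d' a) *\<^sub>R a)"
      by (simp add: scaleR_left_distrib sum.distrib)
    then show ?thesis
      unfolding pos_comb_def using T U
      by (intro CollectI exI [of _ "T \<union> U"] exI [of _ "\<lambda>a. c' a + d' a"])
         (auto simp: c'_def d'_def)
  qed
  show "convex_cone (pos_comb A)"
    using zero scale add by (auto simp: convex_cone_def conic_def convex_def)
  fix C assume C: "A \<subseteq> C" "convex_cone C"
  show "pos_comb A \<subseteq> C"
  proof
    fix x assume "x \<in> pos_comb A"
    then obtain T c where T: "x = (\<Sum>a\<in>T. c a *\<^sub>R a)" "finite T" "T \<subseteq> A" "\<forall>a\<in>T. 0 \<le> c a"
      unfolding pos_comb_def by blast
    from T(2-4) have "(\<Sum>a\<in>T. c a *\<^sub>R a) \<in> C"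
    proof (induction T rule: finite_induct)
      case empty
      show ?case using C(2) by (simp add: convex_cone_contains_0)
    next
      case (insert a T)
      then have "c a *\<^sub>R a \<in> C" using C by (auto intro!: conic_mul simp: convex_cone_def)
      with insert show ?case using C(2) by (auto intro: convex_cone_add)
    qed
    with T(1) show "x \<in> C" by simp
  qed
qed

text \<open>The group \<open>O\<^sub>B(V)\<close> of linear automorphisms preserving a (possibly degenerate) form \<open>B\<close>.\<close>

definition orthogonal_group :: "('v::real_vector \<Rightarrow> 'v \<Rightarrow> real) \<Rightarrow> ('v \<Rightarrow> 'v) monoid"
  where "orthogonal_group B =
    \<lparr>carrier = {f. linear f \<and> bij f \<and> (\<forall>x y. B (f x) (f y) = B x y)},
     monoid.mult = (\<circ>), one = id\<rparr>"

definition reflection :: "('v::real_vector \<Rightarrow> 'v \<Rightarrow> real) \<Rightarrow> 'v \<Rightarrow> 'v \<Rightarrow> 'v"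
  where "reflection B \<alpha> v = v - (2 * B \<alpha> v / B \<alpha> \<alpha>) *\<^sub>R \<alpha>"

definition simple_system :: "('v::real_vector \<Rightarrow> 'v \<Rightarrow> real) \<Rightarrow> 'v set \<Rightarrow> bool"
  where "simple_system B \<Delta> \<longleftrightarrow>
    finite \<Delta> \<and>
    (\<forall>a. (\<forall>\<alpha>\<in>\<Delta>. 0 \<le> a \<alpha>) \<and> (\<Sum>\<alpha>\<in>\<Delta>. a \<alpha> *\<^sub>R \<alpha>) = 0 \<longrightarrow> (\<forall>\<alpha>\<in>\<Delta>. a \<alpha> = 0)) \<and>
    (\<forall>\<alpha>\<in>\<Delta>. \<forall>\<beta>\<in>\<Delta>. \<alpha> \<noteq> \<beta> \<longrightarrow>
       B \<alpha> \<beta> \<in> {..-1} \<union> {- cos (pi / real k) | k. 2 \<le> k}) \<and>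
    (\<forall>\<alpha>\<in>\<Delta>. B \<alpha> \<alpha> = 1)"

text \<open>
  A Coxeter system \<open>(W, S)\<close> with \<open>S\<close> finite that consists of elements of \<open>O\<^sub>B(V)\<close>, where \<open>\<alpha> s\<close> is
  the simple root of \<open>s\<close>.
\<close>

locale geometric_coxeter_system =
  fixes B :: "'v::euclidean_space \<Rightarrow> 'v \<Rightarrow> real"
    and W S :: "('v \<Rightarrow> 'v) set"
    and \<alpha> :: "('v \<Rightarrow> 'v) \<Rightarrow> 'v"
  assumes form_bilinear: "bilinear B"
    and form_symmetric: "\<And>x y. B x y = B y x"
    and subgroup_W: "subgroup W (orthogonal_group B)"
    and coxeter: "coxeter_system (orthogonal_group B\<lparr>carrier := W\<rparr>) S"
    and finite_S: "finite S"
    and simple: "simple_system B (\<alpha> ` S)"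
    and gens_reflections: "\<And>s. s \<in> S \<Longrightarrow> s = reflection B (\<alpha> s)"

definition roots :: "('v \<Rightarrow> 'v) set \<Rightarrow> 'v set \<Rightarrow> 'v set"
  where "roots W \<Delta> = (\<Union>w\<in>W. w ` \<Delta>)"

definition pos_roots :: "('v::real_vector \<Rightarrow> 'v) set \<Rightarrow> 'v set \<Rightarrow> 'v set"
  where "pos_roots W \<Delta> = pos_comb \<Delta> \<inter> roots W \<Delta>"

definition neg_roots :: "('v::real_vector \<Rightarrow> 'v) set \<Rightarrow> 'v set \<Rightarrow> 'v set"
  where "neg_roots W \<Delta> = uminus ` pos_roots W \<Delta>"

definition inversions :: "('v::real_vector \<Rightarrow> 'v) set \<Rightarrow> 'v set \<Rightarrow> ('v \<Rightarrow> 'v) \<Rightarrow> 'v set"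
  where "inversions W \<Delta> w = pos_roots W \<Delta> \<inter> w ` neg_roots W \<Delta>"

definition inversions_of :: "('v::real_vector \<Rightarrow> 'v) set \<Rightarrow> 'v set \<Rightarrow> ('v \<Rightarrow> 'v) set \<Rightarrow> 'v set"
  where "inversions_of W \<Delta> X = (\<Union>x\<in>X. inversions W \<Delta> x)"

definition root_cone :: "('v::real_vector \<Rightarrow> 'v) set \<Rightarrow> 'v set \<Rightarrow> 'v set \<Rightarrow> 'v set"
  where "root_cone W \<Delta> A = pos_comb A \<inter> roots W \<Delta>"


section \<open>Normalized roots and limit roots\<close>

definition affine_hyperplane :: "'v::euclidean_space set \<Rightarrow> bool"
  where "affine_hyperplane H \<longleftrightarrow> affine H \<and> aff_dim H = int DIM('v) - 1"

definition on_ray :: "'v::real_vector set \<Rightarrow> 'v \<Rightarrow> 'v \<Rightarrow> bool"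
  where "on_ray V1 \<beta> x \<longleftrightarrow> x \<in> V1 \<and> x \<noteq> 0 \<and> (\<exists>t>0. x = t *\<^sub>R \<beta>)"

definition transverse :: "'v::real_vector set \<Rightarrow> 'v set \<Rightarrow> bool"
  where "transverse V1 P \<longleftrightarrow> (\<forall>\<beta>\<in>P. \<exists>!x. on_ray V1 \<beta> x)"

text \<open>The argument \<open>P\<close> is the set of positive roots; a root \<open>\<beta> \<notin> P\<close> is normalized through \<open>-\<beta>\<close>.\<close>

definition normalize_root :: "'v::real_vector set \<Rightarrow> 'v set \<Rightarrow> 'v \<Rightarrow> 'v"
  where "normalize_root V1 P \<beta> = (THE x. on_ray V1 (if \<beta> \<in> P then \<beta> else - \<beta>) x)"

definition normalized_inversions_of ::
    "'v::real_vector set \<Rightarrow> ('v \<Rightarrow> 'v) set \<Rightarrow> 'v set \<Rightarrow> ('v \<Rightarrow> 'v) set \<Rightarrow> 'v set"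
  where "normalized_inversions_of V1 W \<Delta> X =
    normalize_root V1 (pos_roots W \<Delta>) ` inversions_of W \<Delta> X"

definition limit_roots :: "'v::euclidean_space set \<Rightarrow> ('v \<Rightarrow> 'v) set \<Rightarrow> 'v set \<Rightarrow> 'v set"
  where "limit_roots V1 W \<Delta> =
    {x. x islimpt (normalize_root V1 (pos_roots W \<Delta>) ` roots W \<Delta>)}"

definition strictly_separated :: "'v::real_vector set \<Rightarrow> 'v set \<Rightarrow> bool"
  where "strictly_separated P Q \<longleftrightarrow>
    (\<exists>\<rho> :: 'v \<Rightarrow> real. linear \<rho> \<and> \<rho> \<noteq> (\<lambda>_. 0) \<and> (\<forall>x\<in>P. \<rho> x > 0) \<and> (\<forall>x\<in>Q. \<rho> x < 0))"

end

theory Submission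
  imports Defs
begin

text \<open>
  The weak order is inclusion of inversion sets (\<open>weak_order_iff_inversions\<close>), so the join of
  \<open>X\<close> is an element whose inversion set is the least one that contains \<open>N(X)\<close>. Inversion sets are
  traces on \<open>\<Phi>\<close> of convex cones; hence the inversion set of an upper bound contains the whole root
  cone of \<open>N(X)\<close>, and the root cone is the natural candidate for \<open>N(\<Or>X)\<close>.

  The combinatorial core is that this candidate works as soon as it is finite
  (\<open>finite_root_cone_is_inversion_set\<close>). Let \<open>C\<close> be a finite set of positive roots that contains
  every root in its cone, and climb from the identity by steps from \<open>w\<close> to \<open>w s\<close> that add a root of
  \<open>C\<close> to the inversion set. If \<open>s\<close> and \<open>t\<close> both allow such a step, finiteness of \<open>C\<close> makes the
  dihedral group of \<open>s\<close> and \<open>t\<close> finite, and its longest element leads to a common upper bound whose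
  inversions still lie in \<open>C\<close>. By the diamond argument there is a greatest element with inversions
  in \<open>C\<close>. It lies above every \<open>x\<close> with \<open>N(x) \<subseteq> C\<close>, in particular above \<open>X\<close>, so for the root cone of
  \<open>N(X)\<close> its inversion set is all of \<open>C\<close>.

  Finiteness of the root cone is a question of accumulation. The normalized roots of the root cone
  lie in the convex hull of the normalized inversions. If \<open>X\<close> is finite, this is a polytope, and
  infinitely many such roots would accumulate at a limit root in it (\<open>finite_root_cone\<close>).
  Conversely, for an upper bound \<open>g\<close> the image under \<open>g\<close> of a linear form that is positive on the
  simple roots separates the inversions of \<open>g\<close> from all other positive roots; because the cone of
  the simple roots is closed, it separates them strictly from the limit roots
  (\<open>bounded_imp_separated\<close>).

  Both parts rest on the classical fact that \<open>w \<alpha>\<^sub>s\<close> is positive if \<open>s\<close> lengthens \<open>w\<close>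
  (\<open>simple_image_pos\<close>), which reduces to explicit computations in dihedral groups.
\<close>

section \<open>Cones\<close>

lemma pos_comb_convex_cone: "convex_cone (pos_comb A)"
  by (simp add: pos_comb_eq_convex_cone_hull convex_cone_convex_cone_hull)

lemma pos_comb_add: "x \<in> pos_comb A \<Longrightarrow> y \<in> pos_comb A \<Longrightarrow> x + y \<in> pos_comb A"
  by (simp add: pos_comb_convex_cone convex_cone_add)

lemma pos_comb_scale: "x \<in> pos_comb A \<Longrightarrow> 0 \<le> r \<Longrightarrow> r *\<^sub>R x \<in> pos_comb A"
  using pos_comb_convex_cone [of A] by (auto simp: convex_cone_def conic_def)

lemma pos_comb_incl: "x \<in> A \<Longrightarrow> x \<in> pos_comb A"
  by (simp add: pos_comb_eq_convex_cone_hull hull_inc)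

lemma pos_comb_sum:
  assumes "\<And>i. i \<in> I \<Longrightarrow> 0 \<le> c i \<and> f i \<in> pos_comb A"
  shows "(\<Sum>i\<in>I. c i *\<^sub>R f i) \<in> pos_comb A"
  using assms
proof (induction I rule: infinite_finite_induct)
  case (insert i I)
  then show ?case by (simp add: pos_comb_add pos_comb_scale)
qed (auto simp: pos_comb_convex_cone convex_cone_contains_0)

lemma pos_comb_linear:
  fixes f :: "'a::real_vector \<Rightarrow> 'b::real_vector"
  assumes "linear f" "\<And>a. a \<in> A \<Longrightarrow> f a \<in> pos_comb D" "x \<in> pos_comb A"
  shows "f x \<in> pos_comb D"
proof -
  obtain T c where T: "x = (\<Sum>a\<in>T. c a *\<^sub>R a)" "T \<subseteq> A" "\<forall>a\<in>T. 0 \<le> c a"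
    using assms(3) unfolding pos_comb_def by blast
  have "f x = (\<Sum>a\<in>T. c a *\<^sub>R f a)"
    unfolding T(1) using assms(1) by (simp add: linear_sum linear_cmul)
  moreover have "(\<Sum>a\<in>T. c a *\<^sub>R f a) \<in> pos_comb D"
    using T assms(2) by (intro pos_comb_sum) auto
  ultimately show ?thesis by simp
qed

lemma pos_comb_subset: "A \<subseteq> pos_comb D \<Longrightarrow> pos_comb A \<subseteq> pos_comb D"
  using pos_comb_linear [of "\<lambda>x. x" A D] by (auto simp: linear_iff)


section \<open>Words and length\<close>

context geometric_coxeter_system
begin

abbreviation G where "G \<equiv> orthogonal_group B\<lparr>carrier := W\<rparr>"
abbreviation simple_roots ("\<Delta>") where "\<Delta> \<equiv> \<alpha> ` S"
abbreviation len where "len \<equiv> word_length G S"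

text \<open>
  On \<open>W\<close> this is the group inverse (\<open>G_inv\<close>); the inverse of functions is preferred because
  elements of \<open>W\<close> are mostly applied to vectors here.
\<close>

abbreviation inverse_map :: "('v \<Rightarrow> 'v) \<Rightarrow> 'v \<Rightarrow> 'v" ("_\<^sup>-\<^sup>1" [1000] 1000)
  where "w\<^sup>-\<^sup>1 \<equiv> inv_into UNIV w"

lemma G_simps [simp]:
  "carrier G = W" "x \<otimes>\<^bsub>orthogonal_group B\<^esub> y = x \<circ> y" "\<one>\<^bsub>orthogonal_group B\<^esub> = id"
  by (simp_all add: orthogonal_group_def)

lemma group_W: "group G"
  using coxeter by (simp add: coxeter_system_def)

lemma gens_in_W: "s \<in> S \<Longrightarrow> s \<in> W"
  using coxeter_system.gens_closed [OF coxeter] by auto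

lemma W_elem:
  assumes "w \<in> W" shows "linear w" "bij w" "B (w x) (w y) = B x y"
  using assms subgroup.subset [OF subgroup_W] by (auto simp: orthogonal_group_def)

lemma W_id: "id \<in> W"
  using group.is_monoid [OF group_W] monoid.one_closed [of G] by simp

lemma W_comp: "u \<in> W \<Longrightarrow> v \<in> W \<Longrightarrow> u \<circ> v \<in> W"
  using group.is_monoid [OF group_W] monoid.m_closed [of G u v] by simp

lemma G_inv: assumes "w \<in> W" shows "inv\<^bsub>G\<^esub> w = w\<^sup>-\<^sup>1" and W_inv: "w\<^sup>-\<^sup>1 \<in> W"
proof -
  have "w \<circ> inv\<^bsub>G\<^esub> w = id"
    using group.r_inv [OF group_W, of w] assms by simp
  moreover have "inv\<^bsub>G\<^esub> w \<in> W"
    using group.inv_closed [OF group_W, of w] assms by simp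
  ultimately show "inv\<^bsub>G\<^esub> w = w\<^sup>-\<^sup>1" "w\<^sup>-\<^sup>1 \<in> W"
    using W_elem(2) [OF assms] by (metis bij_is_inj comp_id inv_o_cancel o_assoc id_comp)+
qed

lemma W_inv_apply [simp]: "w \<in> W \<Longrightarrow> w (w\<^sup>-\<^sup>1 x) = x" "w \<in> W \<Longrightarrow> w\<^sup>-\<^sup>1 (w x) = x"
  using W_elem(2) by (auto simp: bij_def surj_f_inv_f)

lemma W_linear_simps:
  assumes "w \<in> W"
  shows "w (x + y) = w x + w y" "w (x - y) = w x - w y" "w (- x) = - w x" "w (c *\<^sub>R x) = c *\<^sub>R w x"
  using W_elem(1) [OF assms]
  by (auto simp: linear_add linear_diff linear_neg linear_cmul)

lemma form_simps:
  "B (x + y) z = B x z + B y z" "B x (y + z) = B x y + B x z"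
  "B (x - y) z = B x z - B y z" "B x (y - z) = B x y - B x z"
  "B (- x) z = - B x z" "B x (- z) = - B x z"
  "B (c *\<^sub>R x) z = c * B x z" "B x (c *\<^sub>R z) = c * B x z"
  using form_bilinear
  by (auto simp: bilinear_ladd bilinear_radd bilinear_lsub bilinear_rsub bilinear_lneg
      bilinear_rneg bilinear_lmul bilinear_rmul)

lemma form_simple: "s \<in> S \<Longrightarrow> B (\<alpha> s) (\<alpha> s) = 1"
  using simple by (auto simp: simple_system_def)

lemma gen_apply: "s \<in> S \<Longrightarrow> s x = x - (2 * B (\<alpha> s) x) *\<^sub>R \<alpha> s"
  using gens_reflections [of s] form_simple [of s] by (metis div_by_1 reflection_def)

lemma gen_simple: "s \<in> S \<Longrightarrow> s (\<alpha> s) = - \<alpha> s"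
  by (simp add: gen_apply form_simple algebra_simps flip: scaleR_2)

lemma gen_gen: "s \<in> S \<Longrightarrow> s (s x) = x"
  by (subst (2) gen_apply) (simp_all add: W_linear_simps gens_in_W gen_simple, simp add: gen_apply)

lemma gen_involution: "s \<in> S \<Longrightarrow> s \<circ> s = id"
  by (auto simp: gen_gen)

lemma gen_inv: "s \<in> S \<Longrightarrow> s\<^sup>-\<^sup>1 = s"
  by (rule inv_unique_comp) (simp_all add: gen_involution)

lemma alpha_inj: "s \<in> S \<Longrightarrow> t \<in> S \<Longrightarrow> \<alpha> s = \<alpha> t \<Longrightarrow> s = t"
  using gens_reflections by metis

lemma form_simple_distinct:
  assumes "s \<in> S" "t \<in> S" "s \<noteq> t"
  shows "B (\<alpha> s) (\<alpha> t) \<le> -1 \<or> (\<exists>k\<ge>2. B (\<alpha> s) (\<alpha> t) = - cos (pi / real k))"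
proof -
  have "\<alpha> s \<noteq> \<alpha> t" using alpha_inj assms by blast
  moreover have "\<forall>\<beta>\<in>\<Delta>. \<forall>\<gamma>\<in>\<Delta>. \<beta> \<noteq> \<gamma> \<longrightarrow> B \<beta> \<gamma> \<in> {..-1} \<union> {- cos (pi / real k) | k. 2 \<le> k}"
    using simple unfolding simple_system_def by blast
  ultimately have "B (\<alpha> s) (\<alpha> t) \<in> {..-1} \<union> {- cos (pi / real k) | k. 2 \<le> k}"
    using assms by blast
  then show ?thesis by auto
qed

lemma form_simple_nonpos:
  assumes "s \<in> S" "t \<in> S" "s \<noteq> t" shows "B (\<alpha> s) (\<alpha> t) \<le> 0"
proof -
  have "cos (pi / real k) \<ge> 0" if "k \<ge> 2" for k
    using that by (intro cos_ge_zero) (auto simp: field_simps intro: order_trans [of _ 0])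
  then show ?thesis using form_simple_distinct [OF assms] by force
qed

lemma word_prod_simps [simp]:
  "word_prod G [] = id" "word_prod G (x # xs) = x \<circ> word_prod G xs"
  by (simp_all add: word_prod_def)

lemma word_prod_append [simp]: "word_prod G (xs @ ys) = word_prod G xs \<circ> word_prod G ys"
  by (induction xs) (auto simp: o_assoc)

lemma word_prod_in_W: "xs \<in> lists S \<Longrightarrow> word_prod G xs \<in> W"
  by (induction xs) (auto intro: W_id W_comp gens_in_W)

lemma ex_word: "w \<in> W \<Longrightarrow> \<exists>xs \<in> lists S. word_prod G xs = w"
proof -
  assume "w \<in> W"
  then have "w \<in> generate G S"
    using coxeter_system.gens_generate [OF coxeter] by simp
  then show ?thesis
  proof (induction rule: generate.induct)
    case one
    then show ?case by (intro bexI [of _ "[]"]) auto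
  next
    case (incl s)
    then show ?case by (intro bexI [of _ "[s]"]) auto
  next
    case (inv s)
    then show ?case by (intro bexI [of _ "[s]"]) (auto simp: G_inv gens_in_W gen_inv)
  next
    case (eng u v)
    then obtain xs ys where "xs \<in> lists S" "word_prod G xs = u" "ys \<in> lists S" "word_prod G ys = v"
      by blast
    then show ?case by (intro bexI [of _ "xs @ ys"]) auto
  qed
qed

lemma reduced_word:
  assumes "w \<in> W" shows "\<exists>xs \<in> lists S. length xs = len w \<and> word_prod G xs = w"
  unfolding word_length_def
  by (rule LeastI_ex) (use ex_word [OF assms] in blast)

lemma len_word_le: "xs \<in> lists S \<Longrightarrow> len (word_prod G xs) \<le> length xs"
  unfolding word_length_def by (rule Least_le) auto

lemma len_comp_le: "u \<in> W \<Longrightarrow> v \<in> W \<Longrightarrow> len (u \<circ> v) \<le> len u + len v"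
  by (metis reduced_word len_word_le append_in_lists_conv length_append word_prod_append)

lemma len_gen_le: "s \<in> S \<Longrightarrow> len s \<le> 1"
  using len_word_le [of "[s]"] by simp

lemma len_zero: "w \<in> W \<Longrightarrow> len w = 0 \<Longrightarrow> w = id"
  using reduced_word by fastforce

lemma len_id [simp]: "len id = 0"
  using len_word_le [of "[]"] by simp

text \<open>
  Every Coxeter relator has even length, so the presentation makes the parity of a word an
  invariant of the group element. Hence right multiplication by a generator always changes the length.
\<close>

lemma coxeter_equiv_parity: "coxeter_equiv G S xs ys \<Longrightarrow> even (length xs) = even (length ys)"
proof (induction rule: coxeter_equiv.induct)
  case (relator s t xs ys)
  have "length (concat (replicate n [s, t])) = 2 * n" for n
    by (induction n) auto
  then show ?case by simp
qed auto

lemma len_parity: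
  assumes "xs \<in> lists S" shows "even (len (word_prod G xs)) = even (length xs)"
  by (metis assms coxeter coxeter_equiv_parity coxeter_system.presentation reduced_word word_prod_in_W)

lemma len_comp_gen:
  assumes "w \<in> W" "s \<in> S"
  shows "len (w \<circ> s) = len w + 1 \<or> len w = len (w \<circ> s) + 1"
proof -
  have ws: "w \<circ> s \<in> W" using assms by (simp add: W_comp gens_in_W)
  have "w = (w \<circ> s) \<circ> s" using assms by (simp add: gen_involution flip: o_assoc)
  then have "len w \<le> len (w \<circ> s) + 1"
    using len_comp_le [OF ws gens_in_W, of s] len_gen_le assms by fastforce
  moreover have "len (w \<circ> s) \<le> len w + 1"
    using len_comp_le [of w s] len_gen_le [of s] assms gens_in_W by fastforce
  moreover have "even (len (w \<circ> s)) \<noteq> even (len w)"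
  proof -
    obtain xs where xs: "xs \<in> lists S" "word_prod G xs = w" using ex_word assms by blast
    then show ?thesis using len_parity [of "xs @ [s]"] len_parity [of xs] assms by auto
  qed
  ultimately show ?thesis by (metis Suc_eq_plus1 le_Suc_eq le_antisym)
qed

end


section \<open>Dihedral groups and the positivity of roots\<close>

text \<open>
  The composition \<open>\<dots> t \<circ> s \<circ> t\<close> of \<open>n\<close> factors. Recursion peels off the innermost factor, so that the
  last letter of the word is \<open>t\<close> for every \<open>n > 0\<close>, while its first letter depends on parity.
\<close>

fun alternating :: "('a \<Rightarrow> 'a) \<Rightarrow> ('a \<Rightarrow> 'a) \<Rightarrow> nat \<Rightarrow> 'a \<Rightarrow> 'a" where
  "alternating t s 0 = id"
| "alternating t s (Suc n) = alternating s t n \<circ> t"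

lemma alternating_Suc_left:
  "alternating t s (Suc n) = (if even n then t else s) \<circ> alternating t s n"
proof (induction n arbitrary: s t)
  case (Suc n)
  show ?case
    by (subst alternating.simps(2), subst Suc.IH) (simp add: o_assoc)
qed simp

text \<open>
  \<open>chebyshev_U c n\<close> is \<open>U\<^sub>n\<^sub>-\<^sub>1(c / 2)\<close> for the Chebyshev polynomials of the second kind. With
  \<open>c = - 2 B(\<alpha>\<^sub>s, \<alpha>\<^sub>t)\<close> these numbers are the coordinates of the roots of the dihedral group
  generated by \<open>s\<close> and \<open>t\<close>. They stay nonnegative for ever if \<open>c \<ge> 2\<close>, and up to the index \<open>k\<close>
  if \<open>c = 2 cos(\<pi>/k)\<close>.
\<close>

fun chebyshev_U :: "real \<Rightarrow> nat \<Rightarrow> real" where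
  "chebyshev_U c 0 = 0"
| "chebyshev_U c (Suc 0) = 1"
| "chebyshev_U c (Suc (Suc n)) = c * chebyshev_U c (Suc n) - chebyshev_U c n"

lemma chebyshev_U_mono: "2 \<le> c \<Longrightarrow> 0 \<le> chebyshev_U c n \<and> chebyshev_U c n \<le> chebyshev_U c (Suc n)"
proof (induction n)
  case (Suc n)
  then have "2 * chebyshev_U c (Suc n) \<le> c * chebyshev_U c (Suc n)"
    by (intro mult_right_mono) auto
  with Suc show ?case by simp
qed simp

lemma chebyshev_U_cos: "sin x * chebyshev_U (2 * cos x) n = sin (real n * x)"
proof (induction n rule: induct_nat_012)
  case (ge2 n)
  have eq: "real (Suc (Suc n)) * x = real (Suc n) * x + x" "real n * x = real (Suc n) * x - x"
    by (simp_all add: algebra_simps)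
  have "sin x * chebyshev_U (2 * cos x) (Suc (Suc n)) =
    2 * cos x * (sin x * chebyshev_U (2 * cos x) (Suc n)) - sin x * chebyshev_U (2 * cos x) n"
    by (simp add: algebra_simps)
  then show ?case
    unfolding ge2 eq sin_add sin_diff by simp
qed simp_all

context
  fixes k :: nat and c :: real
  assumes k: "2 \<le> k" and c: "c = 2 * cos (pi / real k)"
begin

private lemma sin_pos: "0 < sin (pi / real k)"
  using k by (intro sin_gt_zero) (auto simp: field_simps)

private lemma eq: "chebyshev_U c n = sin (real n * (pi / real k)) / sin (pi / real k)"
  using chebyshev_U_cos [of "pi / real k" n] sin_pos c by (simp add: field_simps)

lemma chebyshev_U_nonneg:
  assumes "n \<le> k" shows "0 \<le> chebyshev_U c n"
proof -
  have "real n * (pi / real k) \<le> pi"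
    using assms k by (simp add: field_simps)
  then have "0 \<le> sin (real n * (pi / real k))" by (intro sin_ge_zero) auto
  with sin_pos show ?thesis by (simp add: eq)
qed

lemma chebyshev_U_values:
  "chebyshev_U c k = 0" "chebyshev_U c (Suc k) = -1" "chebyshev_U c (k - 1) = 1"
proof -
  have "real (Suc k) * (pi / real k) = pi / real k + pi" "real (k - 1) * (pi / real k) = pi - pi / real k"
    "real k * (pi / real k) = pi"
    using k by (auto simp: field_simps of_nat_diff)
  with sin_pos show "chebyshev_U c k = 0" "chebyshev_U c (Suc k) = -1" "chebyshev_U c (k - 1) = 1"
    by (auto simp: eq simp del: of_nat_Suc)
qed

end

context geometric_coxeter_system
begin

lemma alternating_word:
  assumes "s \<in> S" "t \<in> S"
  shows "\<exists>xs \<in> lists S. length xs = k \<and> alternating t s (k + n) = word_prod G xs \<circ> alternating t s n"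
proof (induction k)
  case 0
  show ?case by (intro bexI [of _ "[]"]) auto
next
  case (Suc k)
  then obtain xs where "xs \<in> lists S" "length xs = k"
    "alternating t s (k + n) = word_prod G xs \<circ> alternating t s n" by blast
  with assms show ?case
    by (intro bexI [of _ "(if even (k + n) then t else s) # xs"])
       (auto simp: alternating_Suc_left o_assoc simp del: alternating.simps)
qed

lemma alternating_in_W: "s \<in> S \<Longrightarrow> t \<in> S \<Longrightarrow> alternating t s n \<in> W"
  using alternating_word [of s t n 0] word_prod_in_W by (metis alternating.simps(1) comp_id add_0_right)

lemma alternating_simple:
  assumes "s \<in> S" "t \<in> S" "c = - 2 * B (\<alpha> s) (\<alpha> t)"
  shows "alternating t s n (\<alpha> s) =
    chebyshev_U c (Suc n) *\<^sub>R \<alpha> (if even n then s else t) + chebyshev_U c n *\<^sub>R \<alpha> (if even n then t else s)"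
proof (induction n)
  case (Suc n)
  have "s (\<alpha> t) = \<alpha> t + c *\<^sub>R \<alpha> s" "t (\<alpha> s) = \<alpha> s + c *\<^sub>R \<alpha> t"
    using assms by (auto simp: gen_apply form_symmetric)
  then show ?case
    unfolding alternating_Suc_left comp_apply Suc
    using assms(1,2) by (auto simp: W_linear_simps gens_in_W gen_simple algebra_simps)
qed simp

lemma alternating_fixes:
  assumes "s \<in> S" "t \<in> S" "B (\<alpha> s) x = 0" "B (\<alpha> t) x = 0"
  shows "alternating t s n x = x"
  using assms by (induction n arbitrary: s t) (auto simp: gen_apply)

lemma alternating_braid_simple:
  assumes "s \<in> S" "t \<in> S" and k: "2 \<le> k" "B (\<alpha> s) (\<alpha> t) = - cos (pi / real k)"
  shows "alternating t s k (\<alpha> s) = - \<alpha> (if even k then s else t)"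
    and "alternating t s k (\<alpha> t) = - \<alpha> (if even k then t else s)"
proof -
  define c where "c = - 2 * B (\<alpha> s) (\<alpha> t)"
  have c: "c = 2 * cos (pi / real k)" using k by (simp add: c_def)
  note ends = chebyshev_U_values [OF k(1) c]
  show "alternating t s k (\<alpha> s) = - \<alpha> (if even k then s else t)"
    using alternating_simple [OF assms(1,2) c_def, of k] ends by simp
  obtain j where j: "k = Suc j" using k by (cases k) auto
  have "alternating t s k (\<alpha> t) = - alternating s t j (\<alpha> t)"
    using assms(1,2) by (simp add: j gen_simple W_linear_simps alternating_in_W)
  also have "\<dots> = - \<alpha> (if even k then t else s)"
    using alternating_simple [OF assms(2,1), of c j] ends by (auto simp: j c_def form_symmetric)
  finally show "alternating t s k (\<alpha> t) = - \<alpha> (if even k then t else s)" .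
qed

text \<open>
  Both sides fix the orthogonal complement of the two simple roots, and they agree on the simple
  roots. These two subspaces span the space because the Gram determinant of the simple roots is
  \<open>sin\<^sup>2(\<pi>/k) \<noteq> 0\<close>, even if the form is degenerate elsewhere.
\<close>

lemma alternating_braid:
  assumes "s \<in> S" "t \<in> S" and k: "2 \<le> k" "B (\<alpha> s) (\<alpha> t) = - cos (pi / real k)"
  shows "alternating s t k = alternating t s k"
proof
  fix x
  define b where "b = B (\<alpha> s) (\<alpha> t)"
  \<comment> \<open>Cramer's rule for the component of \<open>x\<close> in the plane of the two simple roots.\<close>
  define p where "p = (B (\<alpha> s) x - b * B (\<alpha> t) x) / (1 - b\<^sup>2)"
  define q where "q = (B (\<alpha> t) x - b * B (\<alpha> s) x) / (1 - b\<^sup>2)"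
  define y where "y = x - p *\<^sub>R \<alpha> s - q *\<^sub>R \<alpha> t"
  have "0 < sin (pi / real k)"
    using k by (intro sin_gt_zero) (auto simp: field_simps)
  then have "1 - b\<^sup>2 \<noteq> 0" using k(2) by (simp add: b_def cos_squared_eq)
  then have "p + q * b = B (\<alpha> s) x" "q + p * b = B (\<alpha> t) x"
    by (simp_all add: p_def q_def divide_simps) (simp_all add: algebra_simps power2_eq_square)
  then have y: "B (\<alpha> s) y = 0" "B (\<alpha> t) y = 0"
    using assms by (auto simp: y_def form_simps form_simple b_def form_symmetric [of "\<alpha> t" "\<alpha> s"])
  have "x = p *\<^sub>R \<alpha> s + q *\<^sub>R \<alpha> t + y" by (simp add: y_def)
  then show "alternating s t k x = alternating t s k x"
    using alternating_braid_simple [OF assms] alternating_braid_simple [OF assms(2,1) k(1)] k(2)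
      alternating_fixes [OF assms(1,2) y] alternating_fixes [OF assms(2,1) y(2,1)]
    by (simp add: W_linear_simps alternating_in_W assms form_symmetric [of "\<alpha> t" "\<alpha> s"])
qed

text \<open>
  The link between lengths and signs of roots. Let \<open>t\<close> be the last letter of a reduced word of \<open>w\<close>
  and write \<open>w = v a\<close>, lengths adding up, with \<open>a\<close> an alternating word in \<open>s\<close> and \<open>t\<close> that ends
  in \<open>t\<close> and is as long as possible. Then \<open>s\<close> and \<open>t\<close> both lengthen \<open>v\<close>, so by induction \<open>v\<close> maps both simple roots
  into the cone. It remains to see that \<open>a\<close> maps \<open>\<alpha>\<^sub>s\<close> to a nonnegative combination of the two
  simple roots. This could fail only if \<open>a\<close> had at least as many letters as the braid relation of
  \<open>s\<close> and \<open>t\<close>; but then \<open>w\<close> would have a reduced word that ends in \<open>s\<close>,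
  and \<open>s\<close> would shorten it.
\<close>

lemma simple_image_pos:
  assumes "w \<in> W" "s \<in> S" "len w < len (w \<circ> s)"
  shows "w (\<alpha> s) \<in> pos_comb \<Delta>"
  using assms
proof (induction "len w" arbitrary: w s rule: less_induct)
  case less
  show ?case
  proof (cases "len w = 0")
    case True
    then have "w = id" using len_zero less.prems by blast
    then show ?thesis using less.prems by (simp add: pos_comb_incl)
  next
    case False
    obtain zs where zs: "zs \<in> lists S" "length zs = len w" "word_prod G zs = w"
      using reduced_word less.prems by blast
    with False obtain xs t where "zs = xs @ [t]" by (metis length_0_conv rev_exhaust)
    with zs have t: "t \<in> S" and xs: "xs \<in> lists S" "w = word_prod G xs \<circ> t" "length xs + 1 = len w"
      by auto
    have wt: "w \<circ> t = word_prod G xs"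
      using xs(2) t by (simp add: gen_involution flip: o_assoc)
    have "s \<noteq> t"
      using wt len_word_le [OF xs(1)] xs(3) less.prems(3) by auto
    define P where "P n \<longleftrightarrow> (\<exists>v\<in>W. w = v \<circ> alternating t s n \<and> len w = len v + n)" for n
    define n where "n = (GREATEST n. P n)"
    have "len w \<le> len (word_prod G xs) + 1"
      using len_comp_le [OF word_prod_in_W [OF xs(1)] gens_in_W [OF t]] len_gen_le [OF t] xs(2)
      by simp
    then have "P 1" unfolding P_def using xs t len_word_le [OF xs(1)]
      by (intro bexI [of _ "word_prod G xs"]) (auto simp: word_prod_in_W)
    moreover have bound: "\<forall>n. P n \<longrightarrow> n \<le> len w" by (auto simp: P_def)
    ultimately have "P n" and max: "\<And>i. P i \<Longrightarrow> i \<le> n"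
      unfolding n_def using GreatestI_nat [of P] Greatest_le_nat [of P] by blast+
    with \<open>P 1\<close> have "1 \<le> n" by blast
    obtain v where v: "v \<in> W" "w = v \<circ> alternating t s n" "len w = len v + n"
      using \<open>P n\<close> by (auto simp: P_def)
    \<comment> \<open>\<open>x\<close> is the first letter of the alternating word, \<open>y\<close> the one that would extend it.\<close>
    define y where "y = (if even n then t else s)"
    define x where "x = (if even n then s else t)"
    have xy: "x \<in> S" "y \<in> S" using t less.prems by (auto simp: x_def y_def)
    have up_y: "len v < len (v \<circ> y)"
    proof (rule ccontr)
      assume "\<not> ?thesis"
      then have "len v = len (v \<circ> y) + 1" using len_comp_gen [OF v(1) xy(2)] by auto
      moreover have "w = (v \<circ> y) \<circ> alternating t s (Suc n)"
        unfolding alternating_Suc_left using v(2) xy(2)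
        by (auto simp: y_def fun_eq_iff gen_gen)
      ultimately have "P (Suc n)"
        unfolding P_def using v xy by (intro bexI [of _ "v \<circ> y"]) (auto simp: W_comp gens_in_W)
      then show False using max [of "Suc n"] by simp
    qed
    obtain i where i: "n = Suc i" using \<open>1 \<le> n\<close> by (cases n) auto
    have up_x: "len v < len (v \<circ> x)"
    proof (rule ccontr)
      assume "\<not> ?thesis"
      then have less_v: "len v = len (v \<circ> x) + 1" using len_comp_gen [OF v(1) xy(1)] by auto
      have "alternating t s n = x \<circ> alternating t s i"
        by (simp add: i x_def alternating_Suc_left del: alternating.simps)
      then have "w = (v \<circ> x) \<circ> alternating t s i" using v(2) by (simp add: o_assoc)
      then have "len w \<le> len (v \<circ> x) + len (alternating t s i)"
        using len_comp_le [of "v \<circ> x"] v(1) xy t less.prems by (simp add: W_comp gens_in_W alternating_in_W)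
      moreover have "len (alternating t s i) \<le> i"
        using alternating_word [of s t i 0] len_word_le t less.prems by fastforce
      ultimately show False using v(3) less_v i by simp
    qed
    define c where "c = - 2 * B (\<alpha> s) (\<alpha> t)"
    have "0 \<le> chebyshev_U c n \<and> 0 \<le> chebyshev_U c (Suc n)"
    proof (cases "B (\<alpha> s) (\<alpha> t) \<le> -1")
      case True
      then show ?thesis using chebyshev_U_mono [of c] by (simp add: c_def)
    next
      case False
      then obtain k where k: "2 \<le> k" "B (\<alpha> s) (\<alpha> t) = - cos (pi / real k)"
        using form_simple_distinct \<open>s \<noteq> t\<close> t less.prems by blast
      then have c: "c = 2 * cos (pi / real k)" by (simp add: c_def)
      have "n < k"
      proof (rule ccontr)
        assume "\<not> n < k"
        then obtain j where j: "n = j + k" by (metis add.commute le_Suc_ex not_less)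
        obtain ys where ys: "ys \<in> lists S" "length ys = j"
          "alternating t s n = word_prod G ys \<circ> alternating t s k"
          using alternating_word [of s t j k] t less.prems by (auto simp: j)
        obtain k' where k': "k = Suc k'" using k by (cases k) auto
        have "alternating t s k = alternating t s k' \<circ> s"
          using alternating_braid [OF less.prems(2) t k] by (simp add: k')
        then have "w \<circ> s = v \<circ> (word_prod G ys \<circ> alternating t s k')"
          using v(2) ys(3) less.prems by (auto simp: fun_eq_iff gen_gen)
        moreover obtain us where "us \<in> lists S" "length us = k'" "alternating t s k' = word_prod G us"
          using alternating_word [of s t k' 0] t less.prems by auto
        ultimately have "len (w \<circ> s) \<le> len v + (j + k')"
          using len_comp_le [of v "word_prod G (ys @ us)"] len_word_le [of "ys @ us"] ys(1,2) v(1)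
          by (simp add: word_prod_in_W W_comp)
        then show False using less.prems(3) v(3) j k' by simp
      qed
      then show ?thesis using chebyshev_U_nonneg [OF k(1) c] by simp
    qed
    moreover have "v (\<alpha> x) \<in> pos_comb \<Delta>" "v (\<alpha> y) \<in> pos_comb \<Delta>"
      using less.hyps [of v] v xy up_x up_y \<open>1 \<le> n\<close> by auto
    moreover have "w (\<alpha> s) = chebyshev_U c (Suc n) *\<^sub>R v (\<alpha> x) + chebyshev_U c n *\<^sub>R v (\<alpha> y)"
      using alternating_simple [OF less.prems(2) t c_def, of n] v(1,2)
      by (simp add: x_def y_def W_linear_simps)
    ultimately show ?thesis by (simp add: pos_comb_add pos_comb_scale)
  qed
qed

end


section \<open>Positive and negative roots\<close>

context geometric_coxeter_system
begin

abbreviation all_roots ("\<Phi>") where "\<Phi> \<equiv> roots W \<Delta>"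
abbreviation positive_roots ("\<Phi>\<^sup>+") where "\<Phi>\<^sup>+ \<equiv> pos_roots W \<Delta>"
abbreviation inversion_set ("N") where "N \<equiv> inversions W \<Delta>"

lemma simple_coefficients:
  assumes "x \<in> pos_comb \<Delta>"
  obtains c where "\<And>s. 0 \<le> c s" "x = (\<Sum>s\<in>S. c s *\<^sub>R \<alpha> s)"
proof -
  obtain T c where T: "x = (\<Sum>a\<in>T. c a *\<^sub>R a)" "T \<subseteq> \<Delta>" "\<forall>a\<in>T. 0 \<le> c a"
    using assms unfolding pos_comb_def by blast
  define d where "d s = (if \<alpha> s \<in> T then c (\<alpha> s) else 0)" for s
  have "x = (\<Sum>a\<in>\<Delta>. (if a \<in> T then c a else 0) *\<^sub>R a)"
    unfolding T(1) using finite_S T(2) by (intro sum.mono_neutral_cong_left) auto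
  also have "\<dots> = (\<Sum>s\<in>S. d s *\<^sub>R \<alpha> s)"
    by (subst sum.reindex) (auto simp: d_def inj_on_def intro: alpha_inj)
  finally show thesis using that [of d] T(3) by (auto simp: d_def)
qed

lemma simple_independent:
  assumes "\<And>s. s \<in> S \<Longrightarrow> 0 \<le> c s" "(\<Sum>s\<in>S. c s *\<^sub>R \<alpha> s) = 0" "s \<in> S"
  shows "c s = 0"
proof -
  have inj: "inj_on \<alpha> S" by (auto simp: inj_on_def intro: alpha_inj)
  define a where "a = c \<circ> the_inv_into S \<alpha>"
  have a: "a (\<alpha> t) = c t" if "t \<in> S" for t
    using that inj by (simp add: a_def the_inv_into_f_f)
  have "(\<Sum>x\<in>\<Delta>. a x *\<^sub>R x) = 0"
    using assms(2) by (subst sum.reindex [OF inj]) (simp add: a)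
  moreover have "\<forall>x\<in>\<Delta>. 0 \<le> a x" using assms(1) by (auto simp: a)
  ultimately have "\<forall>x\<in>\<Delta>. a x = 0" using simple unfolding simple_system_def by blast
  with assms(3) a show ?thesis by force
qed

text \<open>
  Positive independence of the simple roots says that their convex hull misses the origin, so a
  hyperplane through the origin has the whole simple system strictly on one side.
\<close>

lemma ex_positive_functional: "\<exists>a. a \<noteq> 0 \<and> (\<forall>s\<in>S. 0 < a \<bullet> \<alpha> s)"
proof -
  have fin: "finite \<Delta>" using finite_S by simp
  have "0 \<notin> convex hull \<Delta>"
  proof
    assume "0 \<in> convex hull \<Delta>"
    then obtain u where u: "\<forall>x\<in>\<Delta>. 0 \<le> u x" "sum u \<Delta> = 1" "(\<Sum>x\<in>\<Delta>. u x *\<^sub>R x) = 0"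
      unfolding convex_hull_finite [OF fin] by auto
    then have "\<forall>x\<in>\<Delta>. u x = 0" using simple unfolding simple_system_def by blast
    with u(2) show False by simp
  qed
  moreover have "closed (convex hull \<Delta>)"
    using fin finite_imp_compact_convex_hull compact_imp_closed by blast
  ultimately obtain a b where ab: "a \<noteq> 0" "0 < b" "\<forall>x\<in>convex hull \<Delta>. b < a \<bullet> x"
    using separating_hyperplane_closed_0 [of "convex hull \<Delta>"] by auto
  then have "0 < a \<bullet> \<alpha> s" if "s \<in> S" for s
    using that hull_inc [of "\<alpha> s" \<Delta> convex] by force
  with ab(1) show ?thesis by blast
qed

lemma positive_functional_cone:
  assumes a: "\<And>s. s \<in> S \<Longrightarrow> 0 < a \<bullet> \<alpha> s" and x: "x \<in> pos_comb \<Delta>"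
  shows "0 \<le> a \<bullet> x" and "a \<bullet> x = 0 \<Longrightarrow> x = 0"
proof -
  obtain c where c: "\<And>s. 0 \<le> c s" "x = (\<Sum>s\<in>S. c s *\<^sub>R \<alpha> s)"
    using simple_coefficients [OF x] by blast
  have ax: "a \<bullet> x = (\<Sum>s\<in>S. c s * (a \<bullet> \<alpha> s))" by (simp add: c(2) inner_sum_right)
  have nn: "0 \<le> c s * (a \<bullet> \<alpha> s)" if "s \<in> S" for s
    using a [OF that] c(1) by simp
  show "0 \<le> a \<bullet> x" unfolding ax by (intro sum_nonneg nn)
  assume "a \<bullet> x = 0"
  then have "c s * (a \<bullet> \<alpha> s) = 0" if "s \<in> S" for s
    using that sum_nonneg_eq_0_iff [OF finite_S nn] ax by auto
  then have "c s = 0" if "s \<in> S" for s using a that by fastforce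
  then show "x = 0" using c(2) by simp
qed

lemma simple_cone_pointed:
  assumes "x \<in> pos_comb \<Delta>" "- x \<in> pos_comb \<Delta>" shows "x = 0"
proof -
  obtain a where a: "\<And>s. s \<in> S \<Longrightarrow> 0 < a \<bullet> \<alpha> s" using ex_positive_functional by blast
  have "0 \<le> a \<bullet> x" "0 \<le> a \<bullet> (- x)"
    using positive_functional_cone(1) a assms by blast+
  then have "a \<bullet> x = 0" by simp
  then show ?thesis using positive_functional_cone(2) a assms(1) by blast
qed

lemma root_cases:
  assumes "\<beta> \<in> \<Phi>" obtains w s where "w \<in> W" "s \<in> S" "\<beta> = w (\<alpha> s)"
  using assms unfolding roots_def by blast

lemma rootI: "w \<in> W \<Longrightarrow> s \<in> S \<Longrightarrow> w (\<alpha> s) \<in> \<Phi>"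
  unfolding roots_def by blast

lemma root_form: assumes "\<beta> \<in> \<Phi>" shows "B \<beta> \<beta> = 1"
proof -
  obtain w s where "w \<in> W" "s \<in> S" "\<beta> = w (\<alpha> s)" using root_cases assms by blast
  then show ?thesis using W_elem(3) [of w "\<alpha> s" "\<alpha> s"] form_simple by simp
qed

lemma root_image: assumes "w \<in> W" "\<beta> \<in> \<Phi>" shows "w \<beta> \<in> \<Phi>"
proof -
  obtain v s where "v \<in> W" "s \<in> S" "\<beta> = v (\<alpha> s)" using root_cases assms(2) by blast
  then show ?thesis using rootI [of "w \<circ> v" s] W_comp [OF assms(1)] by simp
qed

lemma simple_root_pos: "s \<in> S \<Longrightarrow> \<alpha> s \<in> \<Phi>\<^sup>+"
  unfolding pos_roots_def using rootI [OF W_id] by (simp add: pos_comb_incl)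

lemma pos_root_root: "\<beta> \<in> \<Phi>\<^sup>+ \<Longrightarrow> \<beta> \<in> \<Phi>"
  by (simp add: pos_roots_def)

lemma pos_root_cone: "\<beta> \<in> \<Phi>\<^sup>+ \<Longrightarrow> \<beta> \<in> pos_comb \<Delta>"
  by (simp add: pos_roots_def)

lemma root_neg: assumes "\<beta> \<in> \<Phi>" shows "- \<beta> \<in> \<Phi>"
proof -
  obtain w s where "w \<in> W" "s \<in> S" "\<beta> = w (\<alpha> s)" using root_cases assms by blast
  then have "w \<circ> s \<in> W" "- \<beta> = (w \<circ> s) (\<alpha> s)"
    by (auto simp: W_comp gens_in_W gen_simple W_linear_simps)
  with rootI [of "w \<circ> s" s] \<open>s \<in> S\<close> show ?thesis by simp
qed

lemma root_pos_or_neg: assumes "\<beta> \<in> \<Phi>" shows "\<beta> \<in> \<Phi>\<^sup>+ \<or> - \<beta> \<in> \<Phi>\<^sup>+"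
proof -
  obtain w s where ws: "w \<in> W" "s \<in> S" "\<beta> = w (\<alpha> s)" using root_cases assms by blast
  consider "len (w \<circ> s) = len w + 1" | "len w = len (w \<circ> s) + 1"
    using len_comp_gen ws by blast
  then have "\<beta> \<in> pos_comb \<Delta> \<or> - \<beta> \<in> pos_comb \<Delta>"
  proof cases
    case 1
    then show ?thesis using simple_image_pos ws by auto
  next
    case 2
    have "(w \<circ> s) \<circ> s = w" using ws by (simp add: gen_involution flip: o_assoc)
    then have "(w \<circ> s) (\<alpha> s) \<in> pos_comb \<Delta>"
      using simple_image_pos [of "w \<circ> s" s] ws 2 by (simp add: W_comp gens_in_W)
    then show ?thesis using ws by (simp add: gen_simple W_linear_simps)
  qed
  then show ?thesis using assms root_neg by (auto simp: pos_roots_def)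
qed

lemma pos_root_not_neg: "\<beta> \<in> \<Phi>\<^sup>+ \<Longrightarrow> - \<beta> \<notin> \<Phi>\<^sup>+"
  using simple_cone_pointed [of \<beta>] root_form [of \<beta>] form_simps(7) [of 0 \<beta> \<beta>]
  by (auto simp: pos_roots_def)

end

section \<open>Inversion sets and the weak order\<close>

context geometric_coxeter_system
begin

lemma mem_inversions:
  assumes "w \<in> W" shows "\<beta> \<in> N w \<longleftrightarrow> \<beta> \<in> \<Phi>\<^sup>+ \<and> - (w\<^sup>-\<^sup>1 \<beta>) \<in> \<Phi>\<^sup>+"
proof -
  have "\<beta> \<in> w ` uminus ` \<Phi>\<^sup>+ \<longleftrightarrow> - (w\<^sup>-\<^sup>1 \<beta>) \<in> \<Phi>\<^sup>+"
    using assms by (force simp: image_iff)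
  then show ?thesis by (simp add: inversions_def neg_roots_def)
qed

lemma inversions_pos: "N w \<subseteq> \<Phi>\<^sup>+"
  by (auto simp: inversions_def)

text \<open>
  The simple roots need not be linearly independent, so coefficients cannot be compared. If
  \<open>\<beta>\<close> and \<open>- s \<beta>\<close> are both positive, adding them shows that a multiple \<open>k \<alpha>\<^sub>s\<close> is a nonnegative
  combination of the other simple roots. Since \<open>\<alpha>\<^sub>s\<close> has nonpositive products with these, \<open>k \<le> 0\<close>,
  and positive independence then forces \<open>\<beta>\<close> to be a multiple of \<open>\<alpha>\<^sub>s\<close>.
\<close>

lemma gen_permutes_pos_roots:
  assumes "\<beta> \<in> \<Phi>\<^sup>+" "s \<in> S" "\<beta> \<noteq> \<alpha> s" shows "s \<beta> \<in> \<Phi>\<^sup>+"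
proof (rule ccontr)
  assume "s \<beta> \<notin> \<Phi>\<^sup>+"
  then have "- s \<beta> \<in> \<Phi>\<^sup>+"
    using root_pos_or_neg [OF root_image [OF gens_in_W [OF assms(2)] pos_root_root [OF assms(1)]]]
    by blast
  then obtain d where d: "\<And>t. 0 \<le> d t" "- s \<beta> = (\<Sum>t\<in>S. d t *\<^sub>R \<alpha> t)"
    using simple_coefficients [OF pos_root_cone] by blast
  obtain c where c: "\<And>t. 0 \<le> c t" "\<beta> = (\<Sum>t\<in>S. c t *\<^sub>R \<alpha> t)"
    by (rule simple_coefficients [OF pos_root_cone [OF assms(1)]]) (rule that)
  define k where "k = 2 * B (\<alpha> s) \<beta> - (c s + d s)"
  have "(\<Sum>t\<in>S. (c t + d t) *\<^sub>R \<alpha> t) = (2 * B (\<alpha> s) \<beta>) *\<^sub>R \<alpha> s"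
    unfolding scaleR_left_distrib sum.distrib c(2) [symmetric] d(2) [symmetric]
    using gen_apply [OF assms(2), of \<beta>] by simp
  moreover have "(\<Sum>t\<in>S. (c t + d t) *\<^sub>R \<alpha> t) =
      (c s + d s) *\<^sub>R \<alpha> s + (\<Sum>t\<in>S - {s}. (c t + d t) *\<^sub>R \<alpha> t)"
    using finite_S assms(2) by (subst sum.remove [of _ s]) auto
  ultimately have rest: "(\<Sum>t\<in>S - {s}. (c t + d t) *\<^sub>R \<alpha> t) = k *\<^sub>R \<alpha> s"
    by (simp add: k_def algebra_simps)
  have "B (\<alpha> s) (\<Sum>t\<in>T. (c t + d t) *\<^sub>R \<alpha> t) \<le> 0" if "T \<subseteq> S - {s}" for T
    using finite_subset [OF that] that
  proof (induction T rule: infinite_finite_induct)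
    case (insert t T)
    then have "(c t + d t) * B (\<alpha> s) (\<alpha> t) \<le> 0"
      using c(1) [of t] d(1) [of t] form_simple_nonpos [of s t] assms(2)
      by (auto intro!: mult_nonneg_nonpos)
    with insert finite_S show ?case by (simp add: form_simps)
  qed (use finite_S form_simps(8) [of "\<alpha> s" 0 0] in auto)
  from this [of "S - {s}"] have "k \<le> 0"
    unfolding rest form_simps form_simple [OF assms(2)] by simp
  define e where "e t = (if t = s then - k else c t + d t)" for t
  have "(\<Sum>t\<in>S. e t *\<^sub>R \<alpha> t) = - k *\<^sub>R \<alpha> s + (\<Sum>t\<in>S - {s}. (c t + d t) *\<^sub>R \<alpha> t)"
    using finite_S assms(2) by (subst sum.remove [of _ s]) (auto simp: e_def intro!: sum.cong)
  then have "(\<Sum>t\<in>S. e t *\<^sub>R \<alpha> t) = 0" using rest by simp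
  moreover have "0 \<le> e t" for t using \<open>k \<le> 0\<close> c(1) d(1) by (simp add: e_def)
  ultimately have e0: "e t = 0" if "t \<in> S" for t using simple_independent [of e t] that by simp
  have "c t = 0" if "t \<in> S - {s}" for t
    using that e0 [of t] c(1) [of t] d(1) [of t] by (simp add: e_def)
  then have "\<beta> = c s *\<^sub>R \<alpha> s"
    unfolding c(2) using finite_S assms(2) by (subst sum.remove [of _ s]) auto
  moreover from this have "(c s)\<^sup>2 = 1"
    using root_form [OF pos_root_root [OF assms(1)]] form_simple [OF assms(2)]
    by (simp add: form_simps power2_eq_square)
  ultimately show False using assms(3) c(1) [of s] by (auto simp: power2_eq_1_iff)
qed

lemma inversions_id: "N id = {}"
  using mem_inversions [OF W_id] pos_root_not_neg by auto

lemma inversions_comp_gen: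
  assumes "w \<in> W" "s \<in> S" "w (\<alpha> s) \<in> \<Phi>\<^sup>+"
  shows "N (w \<circ> s) = insert (w (\<alpha> s)) (N w)" and "w (\<alpha> s) \<notin> N w"
proof -
  have ws: "w \<circ> s \<in> W" using assms W_comp gens_in_W by blast
  have inv: "(w \<circ> s)\<^sup>-\<^sup>1 x = s (w\<^sup>-\<^sup>1 x)" for x
    using assms by (simp add: o_inv_distrib W_elem gens_in_W gen_inv)
  show "w (\<alpha> s) \<notin> N w"
    using assms by (simp add: mem_inversions pos_root_not_neg simple_root_pos)
  have "\<beta> \<in> N (w \<circ> s) \<longleftrightarrow> \<beta> = w (\<alpha> s) \<or> \<beta> \<in> N w" for \<beta>
  proof (cases "\<beta> = w (\<alpha> s) \<or> \<beta> \<notin> \<Phi>\<^sup>+")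
    case True
    then show ?thesis using assms ws
      by (auto simp: mem_inversions inv gen_simple simple_root_pos)
  next
    case False
    define \<gamma> where "\<gamma> = w\<^sup>-\<^sup>1 \<beta>"
    have \<gamma>: "\<gamma> \<noteq> \<alpha> s" "\<gamma> \<noteq> - \<alpha> s" "\<gamma> \<in> \<Phi>"
    proof -
      have w\<gamma>: "w \<gamma> = \<beta>" using assms by (simp add: \<gamma>_def)
      show "\<gamma> \<noteq> \<alpha> s" using False w\<gamma> by auto
      show "\<gamma> \<noteq> - \<alpha> s"
        using False w\<gamma> pos_root_not_neg [OF assms(3)] W_linear_simps(3) [OF assms(1)] by auto
      show "\<gamma> \<in> \<Phi>"
        unfolding \<gamma>_def using False pos_root_root root_image [OF W_inv [OF assms(1)]] by blast
    qed
    have s: "s (- \<gamma>) = - s \<gamma>" using assms by (simp add: W_linear_simps gens_in_W)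
    have "- s \<gamma> \<in> \<Phi>\<^sup>+ \<longleftrightarrow> - \<gamma> \<in> \<Phi>\<^sup>+"
    proof (cases "- \<gamma> \<in> \<Phi>\<^sup>+")
      case True
      moreover have "- \<gamma> \<noteq> \<alpha> s" using \<gamma>(2) by (metis minus_minus)
      ultimately show ?thesis using gen_permutes_pos_roots [of "- \<gamma>" s] assms s by auto
    next
      case False
      then have "\<gamma> \<in> \<Phi>\<^sup>+" using root_pos_or_neg \<gamma>(3) by blast
      then have "s \<gamma> \<in> \<Phi>\<^sup>+" using gen_permutes_pos_roots \<gamma>(1) assms by blast
      with False pos_root_not_neg show ?thesis by blast
    qed
    with False assms ws show ?thesis by (simp add: mem_inversions inv \<gamma>_def)
  qed
  then show "N (w \<circ> s) = insert (w (\<alpha> s)) (N w)" by blast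
qed

text \<open>
  Along a reduced word, every letter contributes exactly one new inversion.
\<close>

lemma finite_inversions_card: "w \<in> W \<Longrightarrow> finite (N w) \<and> card (N w) = len w"
proof (induction "len w" arbitrary: w)
  case 0
  then have "w = id" using len_zero by simp
  then show ?case by (metis inversions_id len_id finite.emptyI card.empty)
next
  case (Suc n)
  obtain zs where zs: "zs \<in> lists S" "length zs = len w" "word_prod G zs = w"
    using reduced_word Suc.prems by blast
  with Suc.hyps(2) obtain xs s where "zs = xs @ [s]" by (metis length_0_conv nat.distinct(1) rev_exhaust)
  with zs have s: "s \<in> S" and xs: "xs \<in> lists S" "w = word_prod G xs \<circ> s" "length xs + 1 = len w"
    by auto
  define v where "v = word_prod G xs"
  have v: "v \<in> W" "w = v \<circ> s" "len v \<le> n"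
    using xs len_word_le [OF xs(1)] word_prod_in_W Suc.hyps(2) by (auto simp: v_def)
  then have "len v = n" "len v < len w"
    using len_comp_gen [OF v(1) s] Suc.hyps(2) by auto
  then have IH: "finite (N v)" "card (N v) = len v" using Suc.hyps(1) [of v] v(1) by auto
  have "v (\<alpha> s) \<in> \<Phi>\<^sup>+"
    using simple_image_pos [OF v(1) s] v(2) \<open>len v < len w\<close>
      root_image [OF v(1) pos_root_root [OF simple_root_pos [OF s]]] by (auto simp: pos_roots_def)
  from inversions_comp_gen [OF v(1) s this] IH show ?case
    using v(2) \<open>len v = n\<close> Suc.hyps(2) by simp
qed

lemmas finite_inversions = finite_inversions_card [THEN conjunct1]
lemmas card_inversions = finite_inversions_card [THEN conjunct2]

text \<open>
  A cocycle identity: the inversion sets of \<open>u\<close> and \<open>w\<close> determine that of \<open>u\<^sup>-\<^sup>1 w\<close>. It gives the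
  description of the weak order, the injectivity of \<open>N\<close>, and the upward steps in the weak order.
\<close>

lemma image_inversions_comp:
  assumes "u \<in> W" "w \<in> W"
  shows "u ` N (u\<^sup>-\<^sup>1 \<circ> w) = (N w - N u) \<union> uminus ` (N u - N w)"
proof (rule Set.set_eqI)
  fix \<gamma>
  have uw: "u\<^sup>-\<^sup>1 \<circ> w \<in> W" using assms W_inv W_comp by blast
  have inv: "(u\<^sup>-\<^sup>1 \<circ> w)\<^sup>-\<^sup>1 x = w\<^sup>-\<^sup>1 (u x)" for x
    using assms by (simp add: o_inv_distrib W_elem W_inv bij_imp_bij_inv inv_inv_eq)
  have "\<gamma> \<in> u ` N (u\<^sup>-\<^sup>1 \<circ> w) \<longleftrightarrow> u\<^sup>-\<^sup>1 \<gamma> \<in> N (u\<^sup>-\<^sup>1 \<circ> w)"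
    using assms by (force simp: image_iff)
  also have "\<dots> \<longleftrightarrow> u\<^sup>-\<^sup>1 \<gamma> \<in> \<Phi>\<^sup>+ \<and> - w\<^sup>-\<^sup>1 \<gamma> \<in> \<Phi>\<^sup>+"
    using assms by (simp add: mem_inversions [OF uw] inv)
  also have "\<dots> \<longleftrightarrow> \<gamma> \<in> (N w - N u) \<union> uminus ` (N u - N w)"
  proof (cases "\<gamma> \<in> \<Phi>")
    case True
    have img: "x \<in> uminus ` A \<longleftrightarrow> - x \<in> A" for x :: 'v and A by force
    have neg: "x \<in> \<Phi> \<Longrightarrow> - x \<in> \<Phi>\<^sup>+ \<longleftrightarrow> x \<notin> \<Phi>\<^sup>+" for x
      using root_pos_or_neg [of x] pos_root_not_neg [of x] by blast
    have "u\<^sup>-\<^sup>1 \<gamma> \<in> \<Phi>" "w\<^sup>-\<^sup>1 \<gamma> \<in> \<Phi>" "- u\<^sup>-\<^sup>1 \<gamma> \<in> \<Phi>" "- w\<^sup>-\<^sup>1 \<gamma> \<in> \<Phi>"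
      using True root_image [OF W_inv [OF assms(1)]] root_image [OF W_inv [OF assms(2)]] root_neg
      by simp_all
    then show ?thesis using True assms
      by (auto simp: img mem_inversions neg W_linear_simps W_inv)
  next
    case False
    moreover have "\<gamma> \<in> \<Phi>" if "u\<^sup>-\<^sup>1 \<gamma> \<in> \<Phi>\<^sup>+"
      using root_image [OF assms(1) pos_root_root [OF that]] assms by simp
    moreover have "\<gamma> \<in> \<Phi>" if "\<gamma> \<in> N w" for w using that inversions_pos pos_root_root by blast
    moreover have "\<gamma> \<in> \<Phi>" if "\<gamma> \<in> uminus ` N u"
      using that inversions_pos [of u] pos_root_root root_neg by auto
    ultimately show ?thesis by blast
  qed
  finally show "\<gamma> \<in> u ` N (u\<^sup>-\<^sup>1 \<circ> w) \<longleftrightarrow> \<gamma> \<in> (N w - N u) \<union> uminus ` (N u - N w)" .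
qed

text \<open>
  By the cocycle identity, \<open>u\<^sup>-\<^sup>1 w\<close> has length \<open>|N w - N u| + |N u - N w|\<close>, which equals
  \<open>|N w| - |N u|\<close> precisely when the second summand vanishes.
\<close>

lemma weak_order_iff_inversions:
  assumes "u \<in> W" "w \<in> W"
  shows "u \<sqsubseteq>\<^bsub>weak_order G S\<^esub> w \<longleftrightarrow> N u \<subseteq> N w"
proof -
  note fin = finite_inversions [OF assms(1)] finite_inversions [OF assms(2)]
  have uw: "u\<^sup>-\<^sup>1 \<circ> w \<in> W" using assms W_inv W_comp by blast
  have disj: "(N w - N u) \<inter> uminus ` (N u - N w) = {}"
    using inversions_pos pos_root_not_neg by fastforce
  have "len (u\<^sup>-\<^sup>1 \<circ> w) = card (u ` N (u\<^sup>-\<^sup>1 \<circ> w))"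
    using W_elem(2) [OF assms(1)] card_inversions [OF uw]
    by (metis bij_is_inj card_image inj_on_subset subset_UNIV)
  also have "\<dots> = card (N w - N u) + card (N u - N w)"
    unfolding image_inversions_comp [OF assms] using fin disj
    by (subst card_Un_disjoint) (auto simp: card_image)
  finally have 1: "len (u\<^sup>-\<^sup>1 \<circ> w) = card (N w - N u) + card (N u - N w)" .
  have 2: "len w = card (N w - N u) + card (N u \<inter> N w)" "len u = card (N u - N w) + card (N u \<inter> N w)"
    using card_Int_Diff [OF fin(2), of "N u"] card_Int_Diff [OF fin(1), of "N w"] assms
    by (simp_all add: card_inversions Int_commute)
  have "u \<sqsubseteq>\<^bsub>weak_order G S\<^esub> w \<longleftrightarrow> len w = len u + len (u\<^sup>-\<^sup>1 \<circ> w)"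
    using assms by (simp add: weak_order_def G_inv)
  also have "\<dots> \<longleftrightarrow> card (N u - N w) = 0" using 1 2 by linarith
  also have "\<dots> \<longleftrightarrow> N u \<subseteq> N w" using fin by (simp add: Diff_eq_empty_iff)
  finally show ?thesis .
qed

text \<open>
  If \<open>w\<^sup>-\<^sup>1\<close> keeps every simple root positive, it keeps their cone, hence all positive roots
  positive, and \<open>w\<close> has no inversions at all.
\<close>

lemma inversions_nonempty:
  assumes "w \<in> W" "w \<noteq> id" shows "\<exists>s\<in>S. \<alpha> s \<in> N w"
proof (rule ccontr)
  assume no_simple: "\<not> (\<exists>s\<in>S. \<alpha> s \<in> N w)"
  then have pos: "w\<^sup>-\<^sup>1 (\<alpha> s) \<in> \<Phi>\<^sup>+" if "s \<in> S" for s
    using no_simple that mem_inversions [OF assms(1), of "\<alpha> s"] simple_root_pos [OF that]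
      root_pos_or_neg [OF root_image [OF W_inv [OF assms(1)] pos_root_root], of "\<alpha> s"] by blast
  have "w\<^sup>-\<^sup>1 x \<in> pos_comb \<Delta>" if "x \<in> pos_comb \<Delta>" for x
    using W_elem(1) [OF W_inv [OF assms(1)]] _ that
  proof (rule pos_comb_linear)
    show "w\<^sup>-\<^sup>1 a \<in> pos_comb \<Delta>" if "a \<in> \<Delta>" for a
      using that pos pos_root_cone by auto
  qed
  then have "w\<^sup>-\<^sup>1 \<beta> \<in> \<Phi>\<^sup>+" if "\<beta> \<in> \<Phi>\<^sup>+" for \<beta>
    using that root_image [OF W_inv [OF assms(1)]] by (simp add: pos_roots_def)
  then have "N w = {}"
    using pos_root_not_neg mem_inversions [OF assms(1)] by blast
  then show False using assms len_zero card_inversions [OF assms(1)] by simp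
qed

lemma inversions_inj:
  assumes "u \<in> W" "w \<in> W" "N u = N w" shows "u = w"
proof -
  have uw: "u\<^sup>-\<^sup>1 \<circ> w \<in> W" using assms W_inv W_comp by blast
  have "N (u\<^sup>-\<^sup>1 \<circ> w) = {}" using image_inversions_comp [OF assms(1,2)] assms(3) by auto
  then have "u\<^sup>-\<^sup>1 \<circ> w = id" using inversions_nonempty [OF uw] by auto
  then have "u\<^sup>-\<^sup>1 (w x) = x" for x by (metis comp_apply id_apply)
  then show ?thesis using assms by (metis W_inv_apply(1) ext)
qed

end


section \<open>Finite root cones are inversion sets\<close>

context geometric_coxeter_system
begin

text \<open>
  An inversion set consists of the roots in the intersection of two convex cones, the cone of
  the simple roots and the image under \<open>w\<close> of its opposite.
\<close>

lemma inversions_cone_closed: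
  assumes "w \<in> W" shows "pos_comb (N w) \<inter> \<Phi> \<subseteq> N w"
proof
  fix \<beta> assume \<beta>: "\<beta> \<in> pos_comb (N w) \<inter> \<Phi>"
  have "N w \<subseteq> pos_comb \<Delta>" using inversions_pos pos_root_cone by blast
  then have "\<beta> \<in> \<Phi>\<^sup>+" using \<beta> pos_comb_subset by (auto simp: pos_roots_def)
  have "linear (\<lambda>x. - w\<^sup>-\<^sup>1 x)"
    using W_elem(1) [OF W_inv [OF assms]] by (rule linear_compose_neg)
  then have "- w\<^sup>-\<^sup>1 \<beta> \<in> pos_comb \<Delta>"
  proof (rule pos_comb_linear)
    show "\<beta> \<in> pos_comb (N w)" using \<beta> by simp
    show "- w\<^sup>-\<^sup>1 \<gamma> \<in> pos_comb \<Delta>" if "\<gamma> \<in> N w" for \<gamma>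
      using that mem_inversions [OF assms, of \<gamma>] pos_root_cone by blast
  qed
  moreover have "- w\<^sup>-\<^sup>1 \<beta> \<in> \<Phi>"
    using \<beta> root_image [OF W_inv [OF assms]] root_neg by blast
  ultimately show "\<beta> \<in> N w"
    using \<open>\<beta> \<in> \<Phi>\<^sup>+\<close> mem_inversions [OF assms] by (simp add: pos_roots_def)
qed

text \<open>
  Each letter of an alternating word adds an inversion whose coordinates are two consecutive
  Chebyshev numbers, so as long as these are nonnegative the word is reduced and inverts only
  roots between the two simple roots.
\<close>

lemma alternating_inversions:
  assumes "s \<in> S" "t \<in> S" "c = - 2 * B (\<alpha> s) (\<alpha> t)" "\<And>i. i \<le> n \<Longrightarrow> 0 \<le> chebyshev_U c i"
  shows "N (alternating t s n) \<subseteq> pos_comb {\<alpha> s, \<alpha> t} \<and> card (N (alternating t s n)) = n"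
  using assms
proof (induction n arbitrary: s t)
  case 0
  show ?case unfolding alternating.simps inversions_id by simp
next
  case (Suc n)
  note st = Suc.prems(1,2)
  have c: "c = - 2 * B (\<alpha> t) (\<alpha> s)" using Suc.prems(3) by (simp add: form_symmetric)
  define v where "v = alternating s t n"
  have v: "v \<in> W" using alternating_in_W st by (simp add: v_def)
  have IH: "N v \<subseteq> pos_comb {\<alpha> s, \<alpha> t}" "card (N v) = n"
    using Suc.IH [OF st(2,1) c] Suc.prems(4) by (auto simp: v_def insert_commute)
  have root: "v (\<alpha> t) \<in> pos_comb {\<alpha> s, \<alpha> t}"
    unfolding v_def alternating_simple [OF st(2,1) c]
    using Suc.prems(4) [of n] Suc.prems(4) [of "Suc n"]
    by (intro pos_comb_add pos_comb_scale pos_comb_incl) auto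
  moreover have "{\<alpha> s, \<alpha> t} \<subseteq> pos_comb \<Delta>"
    using st pos_comb_incl [of _ \<Delta>] by simp
  ultimately have "v (\<alpha> t) \<in> \<Phi>\<^sup>+"
    using pos_comb_subset [of "{\<alpha> s, \<alpha> t}"] rootI [OF v st(2)] by (auto simp: pos_roots_def)
  note inversions = inversions_comp_gen [OF v st(2) this]
  have eq: "alternating t s (Suc n) = v \<circ> t" by (simp add: v_def fun_eq_iff)
  have "N (v \<circ> t) \<subseteq> pos_comb {\<alpha> s, \<alpha> t} \<and> card (N (v \<circ> t)) = Suc n"
    unfolding inversions(1) using inversions(2) IH root finite_inversions [OF v] by simp
  then show ?case unfolding eq .
qed

lemma inversions_comp_subset:
  assumes "w \<in> W" "d \<in> W" "w ` N d \<subseteq> \<Phi>\<^sup>+"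
  shows "N (w \<circ> d) = N w \<union> w ` N d"
proof -
  have wd: "w \<circ> d \<in> W" using assms W_comp by blast
  have "w\<^sup>-\<^sup>1 \<circ> (w \<circ> d) = d" using assms by (auto simp: fun_eq_iff)
  then have eq: "w ` N d = (N (w \<circ> d) - N w) \<union> uminus ` (N w - N (w \<circ> d))"
    using image_inversions_comp [OF assms(1) wd] by simp
  have "N w \<subseteq> N (w \<circ> d)"
  proof
    fix x assume "x \<in> N w"
    then have "x \<in> \<Phi>\<^sup>+" using inversions_pos by blast
    then have "- x \<notin> w ` N d" using assms(3) pos_root_not_neg by blast
    with eq \<open>x \<in> N w\<close> show "x \<in> N (w \<circ> d)" by blast
  qed
  with eq show ?thesis by blast
qed

text \<open>
  Local confluence. All roots of the plane of \<open>w \<alpha>\<^sub>s\<close> and \<open>w \<alpha>\<^sub>t\<close> that are nonnegative combinations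
  of these two lie in \<open>C\<close>. Since \<open>C\<close> is finite, \<open>s\<close> and \<open>t\<close> generate a finite dihedral group: in
  the infinite case alternating words would give arbitrarily many such roots. If \<open>d\<close> is the
  longest element of the dihedral group, \<open>w d\<close> lies above both \<open>w s\<close> and \<open>w t\<close>, and the new
  inversions are among the roots of the plane.
\<close>

lemma rank_two_upper_bound:
  assumes w: "w \<in> W" and st: "s \<in> S" "t \<in> S" "s \<noteq> t"
    and C: "finite C" "C \<subseteq> \<Phi>\<^sup>+" "pos_comb C \<inter> \<Phi> \<subseteq> C"
    and sub: "N w \<subseteq> C" "w (\<alpha> s) \<in> C" "w (\<alpha> t) \<in> C"
  shows "\<exists>z\<in>W. N z \<subseteq> C \<and> N (w \<circ> s) \<subseteq> N z \<and> N (w \<circ> t) \<subseteq> N z"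
proof -
  define c where "c = - 2 * B (\<alpha> s) (\<alpha> t)"
  have img: "w ` N d \<subseteq> C" if "d \<in> W" "N d \<subseteq> pos_comb {\<alpha> s, \<alpha> t}" for d
  proof
    fix x assume "x \<in> w ` N d"
    then obtain \<beta> where \<beta>: "x = w \<beta>" "\<beta> \<in> N d" by blast
    then have "w \<beta> \<in> \<Phi>" using inversions_pos pos_root_root root_image [OF w] by blast
    moreover have "w \<beta> \<in> pos_comb C"
      using pos_comb_linear [OF W_elem(1) [OF w], of "{\<alpha> s, \<alpha> t}" C \<beta>] \<beta> that sub pos_comb_incl
      by auto
    ultimately show "x \<in> C" using C(3) \<beta> by blast
  qed
  show ?thesis
  proof (cases "B (\<alpha> s) (\<alpha> t) \<le> -1")
    case True
    define d where "d = alternating t s (Suc (card C))"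
    have d: "d \<in> W" unfolding d_def using st(1,2) by (rule alternating_in_W)
    have "N d \<subseteq> pos_comb {\<alpha> s, \<alpha> t}" "card (N d) = Suc (card C)"
      using alternating_inversions [OF st(1,2) c_def, of "Suc (card C)"] chebyshev_U_mono [of c] True
      by (auto simp: d_def c_def)
    moreover have "card (w ` N d) = card (N d)"
      using W_elem(2) [OF w] by (metis bij_is_inj card_image inj_on_subset subset_UNIV)
    ultimately have False using card_mono [OF C(1) img [OF d]] by simp
    then show ?thesis ..
  next
    case False
    then obtain k where k: "2 \<le> k" "B (\<alpha> s) (\<alpha> t) = - cos (pi / real k)"
      using form_simple_distinct st by blast
    then have c: "c = 2 * cos (pi / real k)" by (simp add: c_def)
    define d where "d = alternating t s k"
    have d: "d \<in> W" unfolding d_def using st(1,2) by (rule alternating_in_W)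
    have "N d \<subseteq> pos_comb {\<alpha> s, \<alpha> t}"
      using alternating_inversions [OF st(1,2) c_def, of k] chebyshev_U_nonneg [OF k(1) c]
      by (simp add: d_def)
    note img = img [OF d this]
    then have N: "N (w \<circ> d) = N w \<union> w ` N d"
      using inversions_comp_subset [OF w d] C(2) by blast
    have simple: "\<alpha> r \<in> N d" if "r \<in> S" "p \<in> S" "d (\<alpha> p) = - \<alpha> r" for r p
    proof -
      have "- d\<^sup>-\<^sup>1 (\<alpha> r) = d\<^sup>-\<^sup>1 (d (\<alpha> p))"
        unfolding that(3) by (simp add: W_linear_simps W_inv d)
      also have "\<dots> = \<alpha> p" using d by simp
      finally show ?thesis
        using that d by (simp add: mem_inversions simple_root_pos)
    qed
    have "\<alpha> s \<in> N d \<and> \<alpha> t \<in> N d"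
      using alternating_braid_simple [OF st(1,2) k, folded d_def] simple st
      by (cases "even k") auto
    then have "N (w \<circ> s) \<subseteq> N (w \<circ> d) \<and> N (w \<circ> t) \<subseteq> N (w \<circ> d)"
      using inversions_comp_gen(1) [OF w st(1)] inversions_comp_gen(1) [OF w st(2)] sub C(2) N by blast
    then show ?thesis
      using N img sub(1) W_comp [OF w d] by blast
  qed
qed

lemma inversions_step:
  assumes "u \<in> W" "x \<in> W" "N u \<subseteq> N x" "u \<noteq> x"
  shows "\<exists>s\<in>S. u (\<alpha> s) \<in> N x - N u"
proof -
  have ux: "u\<^sup>-\<^sup>1 \<circ> x \<in> W" using assms W_inv W_comp by blast
  have "u\<^sup>-\<^sup>1 \<circ> x \<noteq> id"
  proof
    assume "u\<^sup>-\<^sup>1 \<circ> x = id"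
    then have "u\<^sup>-\<^sup>1 (x y) = y" for y by (metis comp_apply id_apply)
    then show False using assms by (metis W_inv_apply(1) ext)
  qed
  then obtain s where "s \<in> S" "\<alpha> s \<in> N (u\<^sup>-\<^sup>1 \<circ> x)" using inversions_nonempty [OF ux] by blast
  then show ?thesis using image_inversions_comp [OF assms(1,2)] assms(3) by blast
qed

text \<open>
  Newman's diamond lemma for the steps from \<open>w\<close> to \<open>w s\<close> that add a root of \<open>C\<close> to the inversion
  set. The steps terminate because \<open>C\<close> is finite, and they are locally confluent by the preceding
  rank two construction. Therefore the elements above \<open>w\<close> whose inversion set lies in \<open>C\<close> have a
  greatest one.
\<close>

lemma greatest_above:
  assumes C: "finite C" "C \<subseteq> \<Phi>\<^sup>+" "pos_comb C \<inter> \<Phi> \<subseteq> C" and w: "w \<in> W" "N w \<subseteq> C"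
  shows "\<exists>m\<in>W. N m \<subseteq> C \<and> (\<forall>x\<in>W. N w \<subseteq> N x \<and> N x \<subseteq> C \<longrightarrow> N x \<subseteq> N m)"
proof -
  define top where
    "top u m \<longleftrightarrow> m \<in> W \<and> N m \<subseteq> C \<and> (\<forall>x\<in>W. N u \<subseteq> N x \<and> N x \<subseteq> C \<longrightarrow> N x \<subseteq> N m)" for u m
  have topD: "N x \<subseteq> N m" if "top u m" "x \<in> W" "N u \<subseteq> N x" "N x \<subseteq> C" for u m x
    using that by (simp add: top_def)
  have top_in: "m \<in> W" "N m \<subseteq> C" if "top u m" for u m
    using that by (auto simp: top_def)
  from w have "\<exists>m. top w m"
  proof (induction "card (C - N w)" arbitrary: w rule: less_induct)
    case less
    note w = less.prems
    have ws: "w \<circ> s \<in> W" if "s \<in> S" for s using that w by (simp add: W_comp gens_in_W)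
    have up: "N (w \<circ> s) = insert (w (\<alpha> s)) (N w)" "w (\<alpha> s) \<notin> N w"
      if "s \<in> S" "w (\<alpha> s) \<in> C" for s
      using inversions_comp_gen [OF w(1) that(1)] that(2) C(2) by blast+
    have step: "\<exists>m. top (w \<circ> s) m" if "s \<in> S" "w (\<alpha> s) \<in> C" for s
    proof (rule less.hyps)
      have "C - N (w \<circ> s) \<subset> C - N w" using up [OF that] that(2) by blast
      then show "card (C - N (w \<circ> s)) < card (C - N w)" using C(1) by (simp add: psubset_card_mono)
      show "w \<circ> s \<in> W" using ws that by simp
      show "N (w \<circ> s) \<subseteq> C" using up [OF that] that(2) w(2) by simp
    qed
    show ?case
    proof (cases "\<exists>s\<in>S. w (\<alpha> s) \<in> C")
      case False
      have "x = w" if x: "x \<in> W" "N w \<subseteq> N x" "N x \<subseteq> C" for x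
      proof (rule ccontr)
        assume "x \<noteq> w"
        then obtain s where "s \<in> S" "w (\<alpha> s) \<in> N x - N w"
          using inversions_step [OF w(1) x(1,2)] by blast
        then show False using False x(3) by blast
      qed
      then have "top w w" using w unfolding top_def by blast
      then show ?thesis by blast
    next
      case True
      then obtain s where s: "s \<in> S" "w (\<alpha> s) \<in> C" by blast
      obtain m where m: "top (w \<circ> s) m" using step [OF s] ..
      have wsm: "N (w \<circ> s) \<subseteq> N m"
        using topD [OF m ws [OF s(1)]] up [OF s] s(2) w(2) by simp
      have "N x \<subseteq> N m" if x: "x \<in> W" "N w \<subseteq> N x" "N x \<subseteq> C" for x
      proof (cases "w = x")
        case True
        then show ?thesis using wsm up(1) [OF s] by blast
      next
        case False
        then obtain t where t: "t \<in> S" "w (\<alpha> t) \<in> N x"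
          using inversions_step [OF w(1) x(1,2)] by blast
        then have tC: "w (\<alpha> t) \<in> C" using x(3) by blast
        obtain m' where m': "top (w \<circ> t) m'" using step [OF t(1) tC] ..
        have wtx: "N (w \<circ> t) \<subseteq> N x" using up(1) [OF t(1) tC] t(2) x(2) by simp
        show ?thesis
        proof (cases "s = t")
          case True
          then show ?thesis using topD [OF m x(1)] wtx x(3) by simp
        next
          case False
          then obtain z where z: "z \<in> W" "N z \<subseteq> C" "N (w \<circ> s) \<subseteq> N z" "N (w \<circ> t) \<subseteq> N z"
            using rank_two_upper_bound [OF w(1) s(1) t(1) _ C w(2) s(2) tC] by blast
          have "N (w \<circ> s) \<subseteq> N m'" using topD [OF m' z(1,4,2)] z(3) by blast
          then have "N m' \<subseteq> N m" using topD [OF m] top_in [OF m'] by blast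
          then show ?thesis using topD [OF m' x(1) wtx x(3)] by blast
        qed
      qed
      then have "top w m" using top_in [OF m] unfolding top_def by blast
      then show ?thesis by blast
    qed
  qed
  then show ?thesis unfolding top_def by blast
qed

lemma inversions_of_subset: "inversions_of W \<Delta> X \<subseteq> root_cone W \<Delta> (inversions_of W \<Delta> X)"
proof
  fix \<beta> assume \<beta>: "\<beta> \<in> inversions_of W \<Delta> X"
  then have "\<beta> \<in> \<Phi>" using inversions_pos pos_root_root by (auto simp: inversions_of_def)
  with pos_comb_incl [OF \<beta>] show "\<beta> \<in> root_cone W \<Delta> (inversions_of W \<Delta> X)"
    by (simp add: root_cone_def)
qed

lemma root_cone_inversions_of_pos: "root_cone W \<Delta> (inversions_of W \<Delta> X) \<subseteq> \<Phi>\<^sup>+"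
proof -
  have "inversions_of W \<Delta> X \<subseteq> pos_comb \<Delta>"
    using inversions_pos pos_root_cone by (auto simp: inversions_of_def)
  then show ?thesis using pos_comb_subset by (auto simp: root_cone_def pos_roots_def)
qed

lemma root_cone_upper_bound:
  assumes "g \<in> W" "\<And>x. x \<in> X \<Longrightarrow> N x \<subseteq> N g"
  shows "root_cone W \<Delta> (inversions_of W \<Delta> X) \<subseteq> N g"
proof -
  have "inversions_of W \<Delta> X \<subseteq> N g" using assms(2) by (auto simp: inversions_of_def)
  then have "inversions_of W \<Delta> X \<subseteq> pos_comb (N g)" using pos_comb_incl by blast
  then have "pos_comb (inversions_of W \<Delta> X) \<subseteq> pos_comb (N g)" by (rule pos_comb_subset)
  then show ?thesis
    unfolding root_cone_def using inversions_cone_closed [OF assms(1)] by blast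
qed

text \<open>
  The greatest element among those with inversions in the root cone lies above all of \<open>X\<close>; as
  inversion sets are closed under cones, it inverts the whole root cone.
\<close>

theorem finite_root_cone_is_inversion_set:
  assumes "X \<subseteq> W" "finite (root_cone W \<Delta> (inversions_of W \<Delta> X))"
  shows "\<exists>m\<in>W. N m = root_cone W \<Delta> (inversions_of W \<Delta> X)"
proof -
  define A where "A = inversions_of W \<Delta> X"
  define C where "C = root_cone W \<Delta> A"
  have C: "finite C" "C \<subseteq> \<Phi>\<^sup>+"
    unfolding C_def A_def using assms(2) root_cone_inversions_of_pos by simp_all
  have "C \<subseteq> pos_comb A" by (auto simp: C_def root_cone_def)
  then have closed: "pos_comb C \<inter> \<Phi> \<subseteq> C"
    using pos_comb_subset [of C A] by (auto simp: C_def root_cone_def)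
  obtain m where m: "m \<in> W" "N m \<subseteq> C" "\<forall>x\<in>W. N id \<subseteq> N x \<and> N x \<subseteq> C \<longrightarrow> N x \<subseteq> N m"
    using greatest_above [OF C closed W_id] unfolding inversions_id by blast
  have "N x \<subseteq> N m" if "x \<in> X" for x
  proof -
    have "N x \<subseteq> A" using that by (auto simp: A_def inversions_of_def)
    then have "N x \<subseteq> C" using inversions_of_subset by (auto simp: C_def A_def)
    then show ?thesis using m(3) that assms(1) by (auto simp: inversions_id)
  qed
  then have "C \<subseteq> N m"
    using root_cone_upper_bound [OF m(1)] by (simp add: C_def A_def)
  with m(1,2) show ?thesis unfolding C_def A_def by blast
qed

end


section \<open>Normalized roots and limit roots\<close>

context geometric_coxeter_system
begin

lemma root_nonzero: assumes "\<beta> \<in> \<Phi>" shows "\<beta> \<noteq> 0"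
  using root_form [OF assms] bilinear_lzero [OF form_bilinear, of 0] by (metis zero_neq_one)

text \<open>
  Transversality forces \<open>V\<^sub>1\<close> to miss the origin as soon as there is a positive root, for otherwise
  it would contain the whole ray of that root. So \<open>V\<^sub>1\<close> is a level set of a linear form that is
  positive on the positive roots, and normalizing a root divides it by its value.
\<close>

lemma height_functional:
  assumes hyp: "affine_hyperplane V1" and trans: "transverse V1 \<Phi>\<^sup>+"
  shows "\<exists>f :: 'v \<Rightarrow> real. linear f \<and>
    (\<forall>\<beta>\<in>\<Phi>\<^sup>+. 0 < f \<beta> \<and> normalize_root V1 \<Phi>\<^sup>+ \<beta> = \<beta> /\<^sub>R f \<beta>)"
proof -
  obtain a b where "affine hull V1 = {x. a \<bullet> x = b}"
    using hyp aff_dim_eq_hyperplane [of V1] unfolding affine_hyperplane_def by auto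
  moreover have "affine hull V1 = V1"
    using hyp by (simp add: affine_hyperplane_def affine_hull_eq)
  ultimately have V1: "V1 = {x. a \<bullet> x = b}" by simp
  define f where "f x = (a \<bullet> x) / b" for x
  have lin: "linear f"
    by (rule linearI) (simp_all add: f_def inner_add_right add_divide_distrib)
  have main: "0 < f \<beta> \<and> normalize_root V1 \<Phi>\<^sup>+ \<beta> = \<beta> /\<^sub>R f \<beta>" if \<beta>: "\<beta> \<in> \<Phi>\<^sup>+" for \<beta>
  proof -
    have ex1: "\<exists>!x. on_ray V1 \<beta> x" using trans \<beta> by (simp add: transverse_def)
    then obtain x where x: "on_ray V1 \<beta> x" by blast
    then obtain t where t: "0 < t" "x = t *\<^sub>R \<beta>" "x \<noteq> 0" "a \<bullet> x = b"
      by (auto simp: on_ray_def V1)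
    have "b \<noteq> 0"
    proof
      assume "b = 0"
      then have "on_ray V1 \<beta> (2 *\<^sub>R x)"
        using t by (auto simp: on_ray_def V1 intro!: exI [of _ "2 * t"])
      then have "2 *\<^sub>R x = x" using ex1 x by blast
      then show False using t(3) by (simp add: scaleR_2)
    qed
    have "f \<beta> = 1 / t" using t \<open>b \<noteq> 0\<close> by (auto simp: f_def)
    moreover have "normalize_root V1 \<Phi>\<^sup>+ \<beta> = x"
      unfolding normalize_root_def using \<beta> ex1 x by (simp add: the1_equality)
    ultimately show ?thesis using t by simp
  qed
  show ?thesis using lin main by blast
qed

lemma normalized_roots:
  "normalize_root V1 \<Phi>\<^sup>+ ` \<Phi> = normalize_root V1 \<Phi>\<^sup>+ ` \<Phi>\<^sup>+"
proof
  show "normalize_root V1 \<Phi>\<^sup>+ ` \<Phi>\<^sup>+ \<subseteq> normalize_root V1 \<Phi>\<^sup>+ ` \<Phi>"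
    by (intro image_mono) (auto simp: pos_roots_def)
  have "normalize_root V1 \<Phi>\<^sup>+ \<beta> \<in> normalize_root V1 \<Phi>\<^sup>+ ` \<Phi>\<^sup>+" if "\<beta> \<in> \<Phi>" for \<beta>
  proof (cases "\<beta> \<in> \<Phi>\<^sup>+")
    case False
    then have "- \<beta> \<in> \<Phi>\<^sup>+" "normalize_root V1 \<Phi>\<^sup>+ \<beta> = normalize_root V1 \<Phi>\<^sup>+ (- \<beta>)"
      using root_pos_or_neg [OF that] by (auto simp: normalize_root_def)
    then show ?thesis by (metis imageI)
  qed simp
  then show "normalize_root V1 \<Phi>\<^sup>+ ` \<Phi> \<subseteq> normalize_root V1 \<Phi>\<^sup>+ ` \<Phi>\<^sup>+" by blast
qed

context
  fixes f :: "'v \<Rightarrow> real"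
  assumes lin: "linear f" and height: "\<forall>\<beta>\<in>\<Phi>\<^sup>+. 0 < f \<beta>"
begin

private lemma pos: "\<beta> \<in> \<Phi>\<^sup>+ \<Longrightarrow> 0 < f \<beta>"
  using height by blast

text \<open>
  Two positive roots on the same ray coincide because both have norm \<open>1\<close> under \<open>B\<close>.
\<close>

lemma normalization_inj: "inj_on (\<lambda>\<beta>. \<beta> /\<^sub>R f \<beta>) \<Phi>\<^sup>+"
proof (rule inj_onI)
  fix \<beta> \<gamma> assume \<beta>\<gamma>: "\<beta> \<in> \<Phi>\<^sup>+" "\<gamma> \<in> \<Phi>\<^sup>+" "\<beta> /\<^sub>R f \<beta> = \<gamma> /\<^sub>R f \<gamma>"
  define k where "k = f \<beta> / f \<gamma>"
  have k: "0 < k" using pos \<beta>\<gamma> by (simp add: k_def)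
  have "f \<beta> *\<^sub>R (\<beta> /\<^sub>R f \<beta>) = f \<beta> *\<^sub>R (\<gamma> /\<^sub>R f \<gamma>)" using \<beta>\<gamma>(3) by simp
  then have \<beta>: "\<beta> = k *\<^sub>R \<gamma>"
    using pos [OF \<beta>\<gamma>(1)] by (simp add: k_def divide_inverse)
  have "k * k = 1"
    using root_form [OF pos_root_root [OF \<beta>\<gamma>(1)]] root_form [OF pos_root_root [OF \<beta>\<gamma>(2)]]
    unfolding \<beta> form_simps by simp
  then have "k = 1" using k by (simp add: square_eq_1_iff)
  with \<beta> show "\<beta> = \<gamma>" by simp
qed

lemma normalized_cone:
  assumes "\<beta> \<in> \<Phi>\<^sup>+" "A \<subseteq> \<Phi>\<^sup>+" "\<beta> \<in> pos_comb A"
  shows "\<beta> /\<^sub>R f \<beta> \<in> convex hull ((\<lambda>\<beta>. \<beta> /\<^sub>R f \<beta>) ` A)"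
proof -
  obtain T c where T: "\<beta> = (\<Sum>a\<in>T. c a *\<^sub>R a)" "finite T" "T \<subseteq> A" "\<forall>a\<in>T. 0 \<le> c a"
    using assms(3) unfolding pos_comb_def by blast
  have posT: "0 < f a" if "a \<in> T" for a using that T(3) assms(2) pos by blast
  have f\<beta>: "0 < f \<beta>" by (rule pos [OF assms(1)])
  have "f \<beta> = (\<Sum>a\<in>T. c a * f a)"
    unfolding T(1) using lin by (simp add: linear_sum linear_cmul)
  then have "(\<Sum>a\<in>T. c a * f a / f \<beta>) = 1"
    using f\<beta> by (simp flip: sum_divide_distrib)
  moreover have "\<forall>a\<in>T. 0 \<le> c a * f a / f \<beta>"
    using T(4) posT f\<beta> by (auto intro!: divide_nonneg_pos mult_nonneg_nonneg simp: less_imp_le)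
  moreover have "a /\<^sub>R f a \<in> convex hull ((\<lambda>\<beta>. \<beta> /\<^sub>R f \<beta>) ` A)" if "a \<in> T" for a
    using that T(3) by (intro hull_inc) auto
  ultimately have "(\<Sum>a\<in>T. (c a * f a / f \<beta>) *\<^sub>R (a /\<^sub>R f a)) \<in> convex hull ((\<lambda>\<beta>. \<beta> /\<^sub>R f \<beta>) ` A)"
    using T(2) by (intro convex_sum) auto
  moreover have "(\<Sum>a\<in>T. (c a * f a / f \<beta>) *\<^sub>R (a /\<^sub>R f a)) = (\<Sum>a\<in>T. c a *\<^sub>R a) /\<^sub>R f \<beta>"
    unfolding scaleR_sum_right
    by (rule sum.cong) (auto dest!: posT simp: field_simps)
  ultimately show ?thesis using T(1) by simp
qed

text \<open>
  If the root cone were infinite, its normalized roots would form an infinite subset of the polytope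
  spanned by the normalized inversions. By compactness they would accumulate at a limit root in
  that polytope.
\<close>

lemma finite_root_cone:
  assumes "X \<subseteq> W" "finite X"
    and disjoint: "convex hull ((\<lambda>\<beta>. \<beta> /\<^sub>R f \<beta>) ` inversions_of W \<Delta> X) \<inter>
      {x. x islimpt (\<lambda>\<beta>. \<beta> /\<^sub>R f \<beta>) ` \<Phi>\<^sup>+} = {}"
  shows "finite (root_cone W \<Delta> (inversions_of W \<Delta> X))"
proof (rule ccontr)
  define A where "A = inversions_of W \<Delta> X"
  define C where "C = root_cone W \<Delta> A"
  define n where "n \<beta> = \<beta> /\<^sub>R f \<beta>" for \<beta>
  assume "infinite (root_cone W \<Delta> (inversions_of W \<Delta> X))"
  then have inf: "infinite C" by (simp add: C_def A_def)
  have C: "C \<subseteq> \<Phi>\<^sup>+" using root_cone_inversions_of_pos by (simp add: C_def A_def)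
  have A: "finite A" "A \<subseteq> \<Phi>\<^sup>+"
    using assms(1,2) finite_inversions inversions_pos by (auto simp: A_def inversions_of_def)
  have "inj_on n C" using normalization_inj C unfolding n_def by (rule inj_on_subset)
  then have "infinite (n ` C)" using inf by (simp add: finite_image_iff)
  moreover have "n ` C \<subseteq> convex hull (n ` A)"
  proof
    fix x assume "x \<in> n ` C"
    then obtain \<beta> where \<beta>: "x = n \<beta>" "\<beta> \<in> C" by blast
    then have "\<beta> \<in> pos_comb A" by (simp add: C_def root_cone_def)
    with \<beta> C A(2) show "x \<in> convex hull (n ` A)"
      using normalized_cone [of \<beta> A] unfolding n_def by blast
  qed
  moreover have "compact (convex hull (n ` A))"
    using A(1) by (simp add: finite_imp_compact_convex_hull)
  ultimately obtain x where x: "x \<in> convex hull (n ` A)" "x islimpt n ` C"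
    unfolding compact_eq_Bolzano_Weierstrass by blast
  have "x islimpt n ` \<Phi>\<^sup>+" using x(2) image_mono [OF C] by (rule islimpt_subset)
  with x(1) disjoint show False unfolding n_def A_def by blast
qed

text \<open>
  Take a linear form that is positive on the simple roots, move it by \<open>g\<close> and change its sign. It
  is positive on \<open>N g\<close>. All but finitely many positive roots lie outside \<open>N g\<close>, and \<open>g\<^sup>-\<^sup>1\<close> maps
  these into the cone of the simple roots. This cone is closed, so \<open>g\<^sup>-\<^sup>1\<close> also maps every limit
  root into it. Limit roots are nonzero, since they have height \<open>1\<close>; hence the form is strictly
  negative there.
\<close>

lemma bounded_imp_separated:
  assumes g: "g \<in> W" and A: "A \<subseteq> N g"
  shows "strictly_separated (convex hull ((\<lambda>\<beta>. \<beta> /\<^sub>R f \<beta>) ` A))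
    (convex hull {x. x islimpt (\<lambda>\<beta>. \<beta> /\<^sub>R f \<beta>) ` \<Phi>\<^sup>+})"
proof -
  define n where "n \<beta> = \<beta> /\<^sub>R f \<beta>" for \<beta>
  obtain a where a: "a \<noteq> 0" "\<And>s. s \<in> S \<Longrightarrow> 0 < a \<bullet> \<alpha> s" using ex_positive_functional by blast
  have cone_pos: "0 < a \<bullet> x" if "x \<in> pos_comb \<Delta>" "x \<noteq> 0" for x
    using positive_functional_cone [of a, OF _ that(1)] a(2) that(2) by force
  have gi: "g\<^sup>-\<^sup>1 \<in> W" using g by (rule W_inv)
  note lin_gi = W_elem(1) [OF gi]
  define \<rho> where "\<rho> x = - (a \<bullet> g\<^sup>-\<^sup>1 x)" for x
  have lin_\<rho>: "linear \<rho>"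
    using lin_gi by (intro linearI) (simp_all add: \<rho>_def linear_add linear_cmul inner_add_right)
  have "\<rho> (g a) < 0" using a(1) g by (simp add: \<rho>_def)
  then have "\<rho> \<noteq> (\<lambda>_. 0)" by auto
  moreover have "0 < \<rho> x" if "x \<in> convex hull (n ` A)" for x
  proof -
    have "n ` A \<subseteq> \<rho> -` {0<..}"
    proof (safe; simp)
      fix \<beta> assume "\<beta> \<in> A"
      then have \<beta>: "\<beta> \<in> \<Phi>\<^sup>+" "- g\<^sup>-\<^sup>1 \<beta> \<in> \<Phi>\<^sup>+" using A mem_inversions [OF g] by blast+
      have "0 < a \<bullet> (- g\<^sup>-\<^sup>1 \<beta>)"
        using \<beta>(2) pos_root_cone root_nonzero pos_root_root cone_pos by blast
      then show "0 < \<rho> (n \<beta>)"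
        using pos [OF \<beta>(1)] lin_\<rho>
        by (simp add: n_def linear_cmul) (simp add: \<rho>_def mult_pos_neg)
    qed
    moreover have "convex (\<rho> -` {0<..})" using lin_\<rho> by (intro convex_linear_vimage) auto
    ultimately have "convex hull (n ` A) \<subseteq> \<rho> -` {0<..}" by (rule hull_minimal)
    with that show ?thesis by auto
  qed
  moreover have "\<rho> x < 0" if "x \<in> convex hull {x. x islimpt n ` \<Phi>\<^sup>+}" for x
  proof -
    have "{x. x islimpt n ` \<Phi>\<^sup>+} \<subseteq> \<rho> -` {..<0}"
    proof (safe; simp)
      fix x assume x: "x islimpt n ` \<Phi>\<^sup>+"
      have "n ` \<Phi>\<^sup>+ = n ` N g \<union> n ` (\<Phi>\<^sup>+ - N g)"
        using inversions_pos [of g] by (subst image_Un [symmetric]) (simp add: Un_absorb1)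
      \<comment> \<open>The finitely many inversions of \<open>g\<close> have no accumulation points.\<close>
      then have "x islimpt n ` (\<Phi>\<^sup>+ - N g)"
        using x finite_inversions [OF g] by (simp add: islimpt_Un_finite)
      then have x_cl: "x \<in> closure (n ` (\<Phi>\<^sup>+ - N g))" by (simp add: closure_def)
      define K where "K = f -` {1} \<inter> (\<lambda>y. g\<^sup>-\<^sup>1 y) -` pos_comb \<Delta>"
      have "n ` (\<Phi>\<^sup>+ - N g) \<subseteq> K"
      proof
        fix y assume "y \<in> n ` (\<Phi>\<^sup>+ - N g)"
        then obtain \<beta> where \<beta>: "y = n \<beta>" "\<beta> \<in> \<Phi>\<^sup>+" "\<beta> \<notin> N g" by blast
        have "g\<^sup>-\<^sup>1 \<beta> \<in> \<Phi>\<^sup>+"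
          using \<beta> mem_inversions [OF g] root_pos_or_neg [OF root_image [OF gi pos_root_root [OF \<beta>(2)]]]
          by blast
        then have "g\<^sup>-\<^sup>1 y \<in> pos_comb \<Delta>"
          using pos [OF \<beta>(2)] pos_root_cone pos_comb_scale [of "g\<^sup>-\<^sup>1 \<beta>" \<Delta> "inverse (f \<beta>)"]
          by (simp add: \<beta>(1) n_def W_linear_simps(4) [OF gi])
        moreover have "f y = 1" using pos [OF \<beta>(2)] lin by (simp add: \<beta>(1) n_def linear_cmul)
        ultimately show "y \<in> K" by (simp add: K_def)
      qed
      moreover have "closed K"
      proof -
        have "closed (pos_comb \<Delta>)"
          unfolding pos_comb_eq_convex_cone_hull using finite_S by (simp add: closed_convex_cone_hull)
        then show ?thesis
          unfolding K_def using lin lin_gi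
          by (intro closed_Int closed_vimage closed_singleton linear_continuous_on)
             (auto simp: linear_conv_bounded_linear)
      qed
      ultimately have "x \<in> K" using x_cl closure_minimal by blast
      then have x: "f x = 1" "g\<^sup>-\<^sup>1 x \<in> pos_comb \<Delta>" by (auto simp: K_def)
      then have "x \<noteq> 0" using lin linear_0 by fastforce
      then have "g\<^sup>-\<^sup>1 x \<noteq> 0"
        using g W_inv_apply(1) [OF g, of x] linear_0 [OF W_elem(1) [OF g]] by metis
      then show "\<rho> x < 0" using cone_pos x(2) by (simp add: \<rho>_def)
    qed
    moreover have "convex (\<rho> -` {..<0})" using lin_\<rho> by (intro convex_linear_vimage) auto
    ultimately have "convex hull {x. x islimpt n ` \<Phi>\<^sup>+} \<subseteq> \<rho> -` {..<0}" by (rule hull_minimal)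
    with that show ?thesis by auto
  qed
  ultimately show ?thesis using lin_\<rho> unfolding strictly_separated_def n_def by blast
qed

end

lemma strictly_separated_disjoint: "strictly_separated P Q \<Longrightarrow> P \<inter> Q = {}"
  unfolding strictly_separated_def by (meson disjoint_iff order_less_asym)

end

section \<open>Existence of joins\<close>

context geometric_coxeter_system
begin

lemma mem_Upper_weak_order:
  assumes "X \<subseteq> W"
  shows "g \<in> Upper (weak_order G S) X \<longleftrightarrow> g \<in> W \<and> (\<forall>x\<in>X. N x \<subseteq> N g)"
proof -
  have "carrier (weak_order G S) = W" by (simp add: weak_order_def)
  then have "g \<in> Upper (weak_order G S) X \<longleftrightarrow> g \<in> W \<and> (\<forall>x\<in>X. x \<sqsubseteq>\<^bsub>weak_order G S\<^esub> g)"
    using assms by (auto simp: Upper_def)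
  also have "\<dots> \<longleftrightarrow> g \<in> W \<and> (\<forall>x\<in>X. N x \<subseteq> N g)"
    using assms weak_order_iff_inversions by blast
  finally show ?thesis .
qed

lemma least_weak_order:
  assumes "X \<subseteq> W"
  shows "least (weak_order G S) m (Upper (weak_order G S) X) \<longleftrightarrow>
    m \<in> W \<and> (\<forall>x\<in>X. N x \<subseteq> N m) \<and> (\<forall>g\<in>W. (\<forall>x\<in>X. N x \<subseteq> N g) \<longrightarrow> N m \<subseteq> N g)"
proof -
  have "Upper (weak_order G S) X \<subseteq> carrier (weak_order G S)" by (auto simp: Upper_def)
  then have "least (weak_order G S) m (Upper (weak_order G S) X) \<longleftrightarrow>
      m \<in> Upper (weak_order G S) X \<and> (\<forall>g. g \<in> Upper (weak_order G S) X \<longrightarrow> m \<sqsubseteq>\<^bsub>weak_order G S\<^esub> g)"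
    unfolding least_def by (simp only: Ball_def simp_thms)
  also have "\<dots> \<longleftrightarrow> m \<in> W \<and> (\<forall>x\<in>X. N x \<subseteq> N m) \<and>
      (\<forall>g\<in>W. (\<forall>x\<in>X. N x \<subseteq> N g) \<longrightarrow> m \<sqsubseteq>\<^bsub>weak_order G S\<^esub> g)"
    unfolding mem_Upper_weak_order [OF assms] by (simp only: Ball_def imp_conjL conj_assoc)
  also have "\<dots> \<longleftrightarrow> m \<in> W \<and> (\<forall>x\<in>X. N x \<subseteq> N m) \<and>
      (\<forall>g\<in>W. (\<forall>x\<in>X. N x \<subseteq> N g) \<longrightarrow> N m \<subseteq> N g)"
    using weak_order_iff_inversions [of m] by (intro conj_cong ball_cong imp_cong) simp_all
  finally show ?thesis .
qed

text \<open>
  An element whose inversion set is the root cone is an upper bound of \<open>X\<close>. The inversion set of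
  any other upper bound contains all \<open>N x\<close>, hence their root cone.
\<close>

lemma inversion_set_is_join:
  assumes "X \<subseteq> W" "m \<in> W" "N m = root_cone W \<Delta> (inversions_of W \<Delta> X)"
  shows "least (weak_order G S) m (Upper (weak_order G S) X)" and "\<Squnion>\<^bsub>weak_order G S\<^esub>X = m"
proof -
  have "N x \<subseteq> N m" if "x \<in> X" for x
    using that inversions_of_subset [of X] assms(3) by (auto simp: inversions_of_def)
  then show least: "least (weak_order G S) m (Upper (weak_order G S) X)"
    unfolding least_weak_order [OF assms(1)]
    using assms(2) unfolding assms(3) by (simp add: root_cone_upper_bound)
  have "m' = m" if "least (weak_order G S) m' (Upper (weak_order G S) X)" for m'
    using that least unfolding least_weak_order [OF assms(1)]
    by (intro inversions_inj) auto
  with least show "\<Squnion>\<^bsub>weak_order G S\<^esub>X = m"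
    unfolding Lattice.sup_def by (rule some_equality)
qed

lemma bounded_imp_finite:
  assumes "X \<subseteq> W" "g \<in> W" "\<forall>x\<in>X. N x \<subseteq> N g" shows "finite X"
proof (rule inj_on_finite)
  show "inj_on N X" using assms(1) inversions_inj by (meson inj_onI subsetD)
  show "N ` X \<subseteq> Pow (N g)" using assms(3) by blast
  show "finite (Pow (N g))" using finite_inversions [OF assms(2)] by simp
qed


text \<open>
  The four conditions form a cycle: a join is an upper bound, an upper bound separates, separated
  sets are disjoint, and disjointness makes the root cone finite, so that it is the inversion set
  of a join.
\<close>

theorem join_characterization:
  fixes X V1
  defines "L \<equiv> weak_order G S"
    and "A \<equiv> convex hull normalized_inversions_of V1 W \<Delta> X"
    and "E \<equiv> convex hull limit_roots V1 W \<Delta>"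
  assumes hyperplane: "affine_hyperplane V1"
    and transv: "transverse V1 \<Phi>\<^sup>+"
    and X: "X \<subseteq> W"
  shows "((\<exists>g. least L g (Upper L X)) \<longleftrightarrow> (\<exists>g\<in>W. \<forall>x\<in>X. x \<sqsubseteq>\<^bsub>L\<^esub> g)) \<and>
    ((\<exists>g\<in>W. \<forall>x\<in>X. x \<sqsubseteq>\<^bsub>L\<^esub> g) \<longleftrightarrow> finite X \<and> A \<inter> E = {}) \<and>
    (finite X \<and> A \<inter> E = {} \<longleftrightarrow> finite X \<and> strictly_separated A E) \<and>
    ((\<exists>g. least L g (Upper L X)) \<longrightarrow> N (\<Squnion>\<^bsub>L\<^esub>X) = root_cone W \<Delta> (inversions_of W \<Delta> X))"
proof -
  let ?R = "inversions_of W \<Delta> X"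
  let ?join = "\<exists>g. least L g (Upper L X)"
  let ?bounded = "\<exists>g\<in>W. \<forall>x\<in>X. x \<sqsubseteq>\<^bsub>L\<^esub> g"
  obtain f :: "'v \<Rightarrow> real" where f: "linear f"
    and height: "\<forall>\<beta>\<in>\<Phi>\<^sup>+. 0 < f \<beta> \<and> normalize_root V1 \<Phi>\<^sup>+ \<beta> = \<beta> /\<^sub>R f \<beta>"
    using height_functional [OF hyperplane transv] by blast
  have pos: "\<forall>\<beta>\<in>\<Phi>\<^sup>+. 0 < f \<beta>" using height by blast
  have "normalized_inversions_of V1 W \<Delta> X = (\<lambda>\<beta>. \<beta> /\<^sub>R f \<beta>) ` ?R"
    unfolding normalized_inversions_of_def
    using height inversions_pos by (intro image_cong) (auto simp: inversions_of_def)
  then have A: "A = convex hull ((\<lambda>\<beta>. \<beta> /\<^sub>R f \<beta>) ` ?R)" by (simp add: A_def)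
  have limits: "limit_roots V1 W \<Delta> = {x. x islimpt (\<lambda>\<beta>. \<beta> /\<^sub>R f \<beta>) ` \<Phi>\<^sup>+}"
    using normalized_roots [of V1] height unfolding limit_roots_def by simp
  have bounded: "?bounded \<longleftrightarrow> (\<exists>g\<in>W. \<forall>x\<in>X. N x \<subseteq> N g)"
    using weak_order_iff_inversions X unfolding L_def by blast
  have "?join \<Longrightarrow> ?bounded"
  proof -
    assume ?join
    then obtain g where "least L g (Upper L X)" ..
    then have "g \<in> W" "\<forall>x\<in>X. N x \<subseteq> N g"
      using least_weak_order [OF X, of g] unfolding L_def by simp_all
    then show ?bounded unfolding bounded by blast
  qed
  moreover have "?bounded \<Longrightarrow> finite X \<and> strictly_separated A E"
  proof -
    assume ?bounded
    then obtain g where g: "g \<in> W" "\<forall>x\<in>X. N x \<subseteq> N g" unfolding bounded by blast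
    then have "?R \<subseteq> N g" by (auto simp: inversions_of_def)
    from bounded_imp_separated [OF f pos g(1) this] bounded_imp_finite [OF X g]
    show ?thesis unfolding A E_def limits by blast
  qed
  moreover have "strictly_separated A E \<Longrightarrow> A \<inter> E = {}"
    by (rule strictly_separated_disjoint)
  moreover have "?join \<and> N (\<Squnion>\<^bsub>L\<^esub>X) = root_cone W \<Delta> ?R" if "finite X" "A \<inter> E = {}"
  proof -
    have "A \<inter> limit_roots V1 W \<Delta> = {}"
      using that(2) hull_subset [of "limit_roots V1 W \<Delta>" convex] unfolding E_def by blast
    then have "finite (root_cone W \<Delta> ?R)"
      using finite_root_cone [OF f pos X that(1)] unfolding A limits by blast
    then obtain m where m: "m \<in> W" "N m = root_cone W \<Delta> ?R"
      using finite_root_cone_is_inversion_set [OF X] by blast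
    from inversion_set_is_join [OF X m] m(2) show ?thesis
      unfolding L_def by auto
  qed
  ultimately show ?thesis by blast
qed

end

theorem theorem3p2:
  fixes B :: "'v::euclidean_space \<Rightarrow> 'v \<Rightarrow> real"
    and W S X :: "('v \<Rightarrow> 'v) set"
    and \<alpha> :: "('v \<Rightarrow> 'v) \<Rightarrow> 'v"
    and V1 :: "'v set"
  defines "\<Delta> \<equiv> \<alpha> ` S"
    and "L \<equiv> weak_order (orthogonal_group B\<lparr>carrier := W\<rparr>) S"
  assumes geometric: "geometric_coxeter_system B W S \<alpha>"
    and hyperplane: "affine_hyperplane V1"
    and transv: "transverse V1 (pos_roots W \<Delta>)"
    and X: "X \<subseteq> W"
  defines "join_exists \<equiv> \<exists>g. least L g (Upper L X)"
    and "bounded_above \<equiv> \<exists>g\<in>W. \<forall>x\<in>X. x \<sqsubseteq>\<^bsub>L\<^esub> g"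
    and "disjoint_hulls \<equiv> finite X \<and>
      convex hull (normalized_inversions_of V1 W \<Delta> X) \<inter> convex hull (limit_roots V1 W \<Delta>) = {}"
    and "separated_hulls \<equiv> finite X \<and>
      strictly_separated (convex hull (normalized_inversions_of V1 W \<Delta> X))
        (convex hull (limit_roots V1 W \<Delta>))"
  shows "(join_exists \<longleftrightarrow> bounded_above) \<and>
    (bounded_above \<longleftrightarrow> disjoint_hulls) \<and>
    (disjoint_hulls \<longleftrightarrow> separated_hulls) \<and>
    (join_exists \<longrightarrow>
      inversions W \<Delta> (\<Squnion>\<^bsub>L\<^esub>X) = root_cone W \<Delta> (inversions_of W \<Delta> X))"
  unfolding join_exists_def bounded_above_def disjoint_hulls_def separated_hulls_def L_def \<Delta>_def
  by (rule geometric_coxeter_system.join_characterization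
      [OF geometric hyperplane transv [unfolded \<Delta>_def] X])

end
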